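(* Let $r\in\mathbb{N}\cup\{\infty\}$ and let $F_r$ be the free group of rank $r$ (for $r=\infty$, of countably infinite rank). Then $s(F_r)=\underline{s}(F_r)=r$.
   Context: $\mathbb{N}=\{1,2,\dots\}$. Sofic dimension of a countable discrete group $G$ with identity $e$ (the specialization to groups of the sofic dimension of a p.m.p. groupoid). Put $I_G=G\cup\{0\}\subseteq\mathbb{C}[G]$, with $g^*=g^{-1}$ for $g\in G$ and $0^*=0$. Let $\tau$ be the canonical trace: $\tau(e)=1$, $\tau(g)=0$ for $g\in G\setminus\{e\}$, $\tau(0)=0$. For $\Omega\subseteq I_G$ let $\Omega^*=\{s^*:s\in\Omega\}$, let $\Omega^k$ be the set of products $s_1\cdots s_k$ with $s_i\in\Omega$, and let $\Omega^{\le n}=\bigcup_{k=1}^n\Omega^k$. Let $I_d$ be the set of partial permutation matrices in $M_d=M_d(\mathbb{C})$ (partial isometries with all entries $0$ or $1$), $\mathrm{tr}$ the normalized trace on $M_d$, and $\|a\|_2=\mathrm{tr}(a^*a)^{1/2}$. For a finite $F\subseteq I_G$, $n,d\in\mathbb{N}$, $\delta>0$, $\mathrm{SA}(F,n,\delta,d)$ is the set of all linear maps $\varphi:\mathbb{C}[G]\to M_d$ such that (1) $\|\varphi(s_1\cdots s_k)-\varphi(s_1)\cdots\varphi(s_k)\|_2<\delta$ for all $k=1,\dots,n$ and $s_1,\dots,s_k\in F\cup F^*$, (2) $\varphi((F\cup F^* )^{\le n})\subseteq I_d$, (3) $|\mathrm{tr}(\varphi(s))-\tau(s)|<\delta$ for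 all $s\in(F\cup F^* )^{\le n}$. For a set $\mathcal{Y}$ of maps, $|\mathcal{Y}|_E$ is the cardinality of the set of restrictions $\{\varphi|_E:\varphi\in\mathcal{Y}\}$. For finite $E,F\subseteq I_G$ set $s_E(F,n,\delta)=\limsup_{d\to\infty}\frac{1}{d\log d}\log|\mathrm{SA}(F,n,\delta,d)|_E$ (with $\log 0=-\infty$) and $s_E(F)=\inf_{n\in\mathbb{N}}\inf_{\delta>0}s_E(F,n,\delta)$. The sofic dimension is $s(G)=\sup_E\inf_F s_E(F)$, where $E$ and $F$ range over the finite subsets of $I_G$. The lower sofic dimension $\underline{s}(G)$ is defined in the same way with $\liminf_{d\to\infty}$ in place of $\limsup_{d\to\infty}$. *)

theory Defs
  imports
    "HOL-Algebra.Group"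
    "HOL-Analysis.Analysis"
    "HOL-Library.Poly_Mapping"
    "Jordan_Normal_Form.Schur_Decomposition"
begin

section \<open>Free groups\<close>

text \<open>
  The free group on a set \<open>I\<close> of generators is realised on reduced words.  The letter \<open>(i, True)\<close>
  stands for the generator \<open>x\<^sub>i\<close> and \<open>(i, False)\<close> for its inverse.
\<close>

definition cancelling :: "'i \<times> bool \<Rightarrow> 'i \<times> bool \<Rightarrow> bool" where
  "cancelling x y \<longleftrightarrow> fst x = fst y \<and> snd x \<noteq> snd y"

definition reduced :: "('i \<times> bool) list \<Rightarrow> bool" where
  "reduced w \<longleftrightarrow> successively (\<lambda>x y. \<not> cancelling x y) w"

fun reduced_Cons :: "'i \<times> bool \<Rightarrow> ('i \<times> bool) list \<Rightarrow> ('i \<times> bool) list" where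
  "reduced_Cons x [] = [x]"
| "reduced_Cons x (y # w) = (if cancelling x y then w else x # y # w)"

text \<open>
  If \<open>v\<close> is reduced, then \<open>foldr reduced_Cons u v\<close> is the reduced form of the concatenation \<open>u @ v\<close>.
\<close>

definition free_group :: "'i set \<Rightarrow> ('i \<times> bool) list monoid" where
  "free_group I =
     \<lparr>carrier = {w. reduced w \<and> fst ` set w \<subseteq> I},
      mult = (\<lambda>u v. foldr reduced_Cons u v),
      one = []\<rparr>"

definition free_group_of_rank :: "enat \<Rightarrow> (nat \<times> bool) list monoid" where
  "free_group_of_rank r = free_group {i. enat i < r}"

lemma reduced_reduced_Cons: "reduced w \<Longrightarrow> reduced (reduced_Cons x w)"
  by (cases w) (auto simp: reduced_def successively_Cons)

lemma reduced_foldr: "reduced w \<Longrightarrow> reduced (foldr reduced_Cons u w)"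
  by (induction u) (auto intro: reduced_reduced_Cons)

lemma reduced_Cons_cancel:
  assumes "cancelling x y" "reduced w"
  shows "reduced_Cons x (reduced_Cons y w) = w"
proof (cases w)
  case Nil
  then show ?thesis using assms by simp
next
  case (Cons z v)
  show ?thesis
  proof (cases "cancelling y z")
    case True
    then have "z = x" using assms(1) by (auto simp: cancelling_def prod_eq_iff)
    then show ?thesis using Cons True assms(2)
      by (cases v) (auto simp: reduced_def)
  next
    case False
    then show ?thesis using Cons assms(1) by simp
  qed
qed

lemma foldr_reduced_Cons_reduced_Cons:
  assumes "reduced w"
  shows "foldr reduced_Cons (reduced_Cons x u) w = reduced_Cons x (foldr reduced_Cons u w)"
  using assms by (cases u) (auto simp: reduced_Cons_cancel reduced_foldr)

lemma foldr_reduced_Cons_assoc: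
  assumes "reduced w"
  shows "foldr reduced_Cons (foldr reduced_Cons u v) w
         = foldr reduced_Cons u (foldr reduced_Cons v w)"
  using assms by (induction u) (auto simp: foldr_reduced_Cons_reduced_Cons)

lemma set_reduced_Cons: "set (reduced_Cons x w) \<subseteq> insert x (set w)"
  by (cases w) auto

lemma set_foldr_reduced_Cons: "set (foldr reduced_Cons u w) \<subseteq> set u \<union> set w"
  by (induction u) (use set_reduced_Cons in fastforce)+

lemma foldr_reduced_Cons_Nil: "reduced u \<Longrightarrow> foldr reduced_Cons u [] = u"
proof (induction u)
  case (Cons x u)
  then show ?case by (cases u) (auto simp: reduced_def)
qed simp

lemma reduced_rev_inverse:
  assumes "reduced w"
  shows "reduced (rev (map (apsnd Not) w))"
proof -
  have "successively (\<lambda>x y. \<not> cancelling (apsnd Not y) (apsnd Not x)) w"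
    using assms unfolding reduced_def
    by (rule successively_mono) (auto simp: cancelling_def)
  then show ?thesis
    by (simp add: reduced_def successively_rev successively_map)
qed

lemma foldr_inverse_word:
  assumes "reduced v"
  shows "foldr reduced_Cons (rev (map (apsnd Not) w)) (foldr reduced_Cons w v) = v"
  using assms
proof (induction w)
  case (Cons x w)
  then show ?case
    by (simp add: reduced_Cons_cancel reduced_foldr cancelling_def)
qed simp

theorem group_free_group: "group (free_group I)"
proof (rule groupI)
  fix u v
  assume "u \<in> carrier (free_group I)" "v \<in> carrier (free_group I)"
  then show "u \<otimes>\<^bsub>free_group I\<^esub> v \<in> carrier (free_group I)"
    using set_foldr_reduced_Cons[of u v] by (fastforce simp: free_group_def reduced_foldr)
next
  fix w
  assume "w \<in> carrier (free_group I)"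
  then have w: "reduced w" "fst ` set w \<subseteq> I" by (auto simp: free_group_def)
  let ?v = "rev (map (apsnd Not) w)"
  have "foldr reduced_Cons ?v w = []"
    using foldr_inverse_word[of "[]" w] foldr_reduced_Cons_Nil[OF w(1)]
    by (simp add: reduced_def)
  moreover have "reduced ?v" "fst ` set ?v \<subseteq> I"
    using w by (auto simp: reduced_rev_inverse)
  ultimately show "\<exists>v\<in>carrier (free_group I). v \<otimes>\<^bsub>free_group I\<^esub> w = \<one>\<^bsub>free_group I\<^esub>"
    by (intro bexI[of _ ?v]) (simp_all add: free_group_def)
qed (auto simp: free_group_def foldr_reduced_Cons_assoc reduced_def[of "[]"])


section \<open>The group algebra over the complex numbers\<close>

text \<open>
  An element of \<open>\<complex>[G]\<close> is a finitely supported function on the type of \<open>G\<close> whose support is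
  contained in the carrier.
\<close>

definition group_alg :: "('g, 'm) monoid_scheme \<Rightarrow> ('g \<Rightarrow>\<^sub>0 complex) set" where
  "group_alg G = {p. Poly_Mapping.keys p \<subseteq> carrier G}"

definition ga_smult :: "complex \<Rightarrow> ('g \<Rightarrow>\<^sub>0 complex) \<Rightarrow> ('g \<Rightarrow>\<^sub>0 complex)" where
  "ga_smult c p = Poly_Mapping.map ((*) c) p"

definition ga_of :: "'g \<Rightarrow> ('g \<Rightarrow>\<^sub>0 complex)" where
  "ga_of g = Poly_Mapping.single g 1"

text \<open>
  The product of \<open>\<complex>[G]\<close> is convolution with respect to the multiplication of the record \<open>G\<close>; it is
  not the type class product of \<^typ>\<open>'g \<Rightarrow>\<^sub>0 complex\<close>.
\<close>

definition ga_mult ::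
  "('g, 'm) monoid_scheme \<Rightarrow> ('g \<Rightarrow>\<^sub>0 complex) \<Rightarrow> ('g \<Rightarrow>\<^sub>0 complex) \<Rightarrow> ('g \<Rightarrow>\<^sub>0 complex)" where
  "ga_mult G p q =
     (\<Sum>g\<in>Poly_Mapping.keys p. \<Sum>h\<in>Poly_Mapping.keys q.
        Poly_Mapping.single (g \<otimes>\<^bsub>G\<^esub> h) (Poly_Mapping.lookup p g * Poly_Mapping.lookup q h))"

definition ga_prod :: "('g, 'm) monoid_scheme \<Rightarrow> ('g \<Rightarrow>\<^sub>0 complex) list \<Rightarrow> ('g \<Rightarrow>\<^sub>0 complex)" where
  "ga_prod G ss = foldr (ga_mult G) ss (ga_of \<one>\<^bsub>G\<^esub>)"

definition ga_star :: "('g, 'm) monoid_scheme \<Rightarrow> ('g \<Rightarrow>\<^sub>0 complex) \<Rightarrow> ('g \<Rightarrow>\<^sub>0 complex)" where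
  "ga_star G p =
     (\<Sum>g\<in>Poly_Mapping.keys p.
        Poly_Mapping.single (inv\<^bsub>G\<^esub> g) (cnj (Poly_Mapping.lookup p g)))"

definition ga_trace :: "('g, 'm) monoid_scheme \<Rightarrow> ('g \<Rightarrow>\<^sub>0 complex) \<Rightarrow> complex" where
  "ga_trace G p = Poly_Mapping.lookup p \<one>\<^bsub>G\<^esub>"

definition I_group :: "('g, 'm) monoid_scheme \<Rightarrow> ('g \<Rightarrow>\<^sub>0 complex) set" where
  "I_group G = insert 0 (ga_of ` carrier G)"

definition ga_powers_upto ::
  "('g, 'm) monoid_scheme \<Rightarrow> ('g \<Rightarrow>\<^sub>0 complex) set \<Rightarrow> nat \<Rightarrow> ('g \<Rightarrow>\<^sub>0 complex) set" where
  "ga_powers_upto G S n =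
     (\<Union>k\<in>{1..n}. {ga_prod G ss | ss. length ss = k \<and> set ss \<subseteq> S})"


section \<open>Matrices\<close>

definition normalized_trace :: "nat \<Rightarrow> complex mat \<Rightarrow> complex" where
  "normalized_trace d A = (\<Sum>i<d. A $$ (i, i)) / of_nat d"

definition norm_2 :: "nat \<Rightarrow> complex mat \<Rightarrow> real" where
  "norm_2 d A = sqrt (Re (normalized_trace d (mat_adjoint A * A)))"

definition mat_prod :: "nat \<Rightarrow> complex mat list \<Rightarrow> complex mat" where
  "mat_prod d As = foldr (*) As (1\<^sub>m d)"

definition partial_isometry :: "complex mat \<Rightarrow> bool" where
  "partial_isometry A \<longleftrightarrow> A * mat_adjoint A * A = A"

definition partial_permutation_mats :: "nat \<Rightarrow> complex mat set" where
  "partial_permutation_mats d =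
     {A \<in> carrier_mat d d. partial_isometry A \<and> (\<forall>i<d. \<forall>j<d. A $$ (i, j) \<in> {0, 1})}"


section \<open>Sofic dimension\<close>

text \<open>
  Values of the maps outside the group algebra are unconstrained; only restrictions to subsets of
  the group algebra are ever counted.
\<close>

definition linear_to_mats ::
  "('g, 'm) monoid_scheme \<Rightarrow> nat \<Rightarrow> (('g \<Rightarrow>\<^sub>0 complex) \<Rightarrow> complex mat) set" where
  "linear_to_mats G d =
     {\<phi>. (\<forall>p\<in>group_alg G. \<phi> p \<in> carrier_mat d d) \<and>
         (\<forall>p\<in>group_alg G. \<forall>q\<in>group_alg G. \<phi> (p + q) = \<phi> p + \<phi> q) \<and>
         (\<forall>c. \<forall>p\<in>group_alg G. \<phi> (ga_smult c p) = c \<cdot>\<^sub>m \<phi> p)}"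

definition SA ::
  "('g, 'm) monoid_scheme \<Rightarrow> ('g \<Rightarrow>\<^sub>0 complex) set \<Rightarrow> nat \<Rightarrow> real \<Rightarrow> nat
     \<Rightarrow> (('g \<Rightarrow>\<^sub>0 complex) \<Rightarrow> complex mat) set" where
  "SA G F n \<delta> d =
     {\<phi> \<in> linear_to_mats G d.
        let S = F \<union> ga_star G ` F in
        (\<forall>k\<in>{1..n}. \<forall>ss. length ss = k \<and> set ss \<subseteq> S \<longrightarrow>
           norm_2 d (\<phi> (ga_prod G ss) - mat_prod d (map \<phi> ss)) < \<delta>) \<and>
        \<phi> ` ga_powers_upto G S n \<subseteq> partial_permutation_mats d \<and>
        (\<forall>s\<in>ga_powers_upto G S n. cmod (normalized_trace d (\<phi> s) - ga_trace G s) < \<delta>)}"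

text \<open>
  Logarithm of a cardinality.  The set of restrictions counted below can be infinite when the
  elements of \<open>E\<close> are not products of elements of \<open>F\<close> and their adjoints, so infinite sets have to
  be sent to \<open>\<infinity>\<close>.
\<close>

definition ln_card :: "'a set \<Rightarrow> ereal" where
  "ln_card A =
     (if infinite A then \<infinity> else if A = {} then -\<infinity> else ereal (ln (real (card A))))"

text \<open>
  The parameter \<open>L\<close> is the limit operation in the dimension \<open>d\<close>: \<open>limsup\<close> or \<open>liminf\<close>.
\<close>

definition sofic_rate ::
  "((nat \<Rightarrow> ereal) \<Rightarrow> ereal) \<Rightarrow> ('g, 'm) monoid_scheme \<Rightarrow> ('g \<Rightarrow>\<^sub>0 complex) set
     \<Rightarrow> ('g \<Rightarrow>\<^sub>0 complex) set \<Rightarrow> nat \<Rightarrow> real \<Rightarrow> ereal" where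
  "sofic_rate L G E F n \<delta> =
     L (\<lambda>d. ln_card ((\<lambda>\<phi>. restrict \<phi> E) ` SA G F n \<delta> d) / ereal (real d * ln (real d)))"

definition sofic_dimension_with ::
  "((nat \<Rightarrow> ereal) \<Rightarrow> ereal) \<Rightarrow> ('g, 'm) monoid_scheme \<Rightarrow> ereal" where
  "sofic_dimension_with L G =
     (SUP E\<in>{E. finite E \<and> E \<subseteq> I_group G}.
        INF F\<in>{F. finite F \<and> F \<subseteq> I_group G}.
          INF n\<in>{1..}. INF \<delta>\<in>{0<..}. sofic_rate L G E F n \<delta>)"

definition sofic_dimension :: "('g, 'm) monoid_scheme \<Rightarrow> ereal" where
  "sofic_dimension G = sofic_dimension_with limsup G"

definition lower_sofic_dimension :: "('g, 'm) monoid_scheme \<Rightarrow> ereal" where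
  "lower_sofic_dimension G = sofic_dimension_with liminf G"

end

theory Submission
  imports Defs "HOL-Real_Asymp.Real_Asymp"
begin

text \<open>
  For the upper bound let the rank \<open>r\<close> be finite. A sofic approximation \<open>\<phi>\<close> of the free group is almost
  determined by its values at the \<open>r\<close> generators. These are partial permutation matrices, of which there
  are at most \<open>(d + 1)\<^sup>d\<close>, so that the generators contribute \<open>r\<close> to the growth rate on the scale
  \<open>d log d\<close>. If \<open>F\<close> contains all words of length at most \<open>m\<close>, the value at each of them agrees, outside
  of \<open>O(\<delta> d)\<close> entries, with a prediction from the values at shorter words: a product, or a transpose in
  case of the inverse of a generator (\<open>card_diff_predicted\<close>). A set of \<open>O(\<delta> d)\<close> entries can be chosen in
  \<open>exp (O(\<delta> d log d))\<close> ways, and this disappears from the rate as \<open>\<delta>\<close> tends to 0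
  (\<open>card_restrictions_le\<close>, \<open>limsup_rate_le\<close>).

  For the lower bound take finitely many generators \<open>x\<^sub>i\<close>, \<open>i \<in> J\<close>, as the set \<open>E\<close>. Any tuple of
  permutations of \<open>d\<close> points extends to a representation of the free group by permutation matrices, which
  satisfies all conditions on a sofic approximation but the one on traces. That one asks that finitely
  many nontrivial reduced words have few fixed points, and this is true for most tuples: if a word fixes
  a point, the path of that point under its letters runs into itself, and the step that does so can be
  redirected to any unvisited point without a change in the earlier part of the path. So a self-intersection
  has probability \<open>O(1 / d)\<close> (\<open>card_collision_at\<close>, \<open>card_fixing_word\<close>,
  \<open>most_tuples_few_fixed_points\<close>). At least half of the \<open>(d!)\<^bsup>card J\<^esup>\<close> tuples on \<open>J\<close> therefore come
  from sofic approximations (\<open>card_restrictions_ge\<close>), and \<open>log d!\<close> is asymptotic to \<open>d log d\<close>, so even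
  the lower sofic dimension is at least \<open>card J\<close>. In infinite rank \<open>J\<close> can be as large as desired.
\<close>

section \<open>Group elements inside the group algebra\<close>

lemma ga_mult_ga_of: "ga_mult G (ga_of g) (ga_of h) = ga_of (g \<otimes>\<^bsub>G\<^esub> h)"
  by (simp add: ga_mult_def ga_of_def)

lemma ga_mult_zero [simp]: "ga_mult G 0 q = 0" "ga_mult G p 0 = 0"
  by (simp_all add: ga_mult_def)

lemma ga_star_ga_of: "ga_star G (ga_of g) = ga_of (inv\<^bsub>G\<^esub> g)"
  by (simp add: ga_star_def ga_of_def)

lemma ga_star_zero [simp]: "ga_star G 0 = 0"
  by (simp add: ga_star_def)

lemma inj_ga_of: "inj ga_of"
  unfolding ga_of_def inj_def by (metis keys_single singleton_inject zero_neq_one)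

lemma I_group_mult:
  assumes "group G" "p \<in> I_group G" "q \<in> I_group G"
  shows "ga_mult G p q \<in> I_group G"
  using assms
  by (auto simp: I_group_def ga_mult_ga_of group.is_monoid monoid.m_closed)

lemma I_group_star:
  assumes "group G" "p \<in> I_group G"
  shows "ga_star G p \<in> I_group G"
  using assms by (auto simp: I_group_def ga_star_ga_of)

lemma I_group_prod:
  assumes "group G" "set ss \<subseteq> I_group G"
  shows "ga_prod G ss \<in> I_group G"
  using assms(2)
proof (induction ss)
  case Nil
  then show ?case
    using assms(1) by (simp add: ga_prod_def I_group_def group.is_monoid monoid.one_closed)
next
  case (Cons p ss)
  then show ?case using I_group_mult[OF assms(1), of p "ga_prod G ss"] by (simp add: ga_prod_def)
qed

lemma ga_mult_one:
  assumes "group G" "p \<in> I_group G"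
  shows "ga_mult G p (ga_of \<one>\<^bsub>G\<^esub>) = p"
  using assms by (auto simp: I_group_def ga_mult_ga_of group.is_monoid)

lemma ga_powers_upto_I_group:
  assumes "group G" "S \<subseteq> I_group G"
  shows "ga_powers_upto G S n \<subseteq> I_group G"
  using I_group_prod[OF assms(1)] assms(2) by (fastforce simp: ga_powers_upto_def)

lemma ga_powers_upto_single:
  assumes "group G" "S \<subseteq> I_group G" "p \<in> S" "1 \<le> n"
  shows "p \<in> ga_powers_upto G S n"
proof -
  have "ga_prod G [p] = p" using assms by (auto simp: ga_prod_def intro: ga_mult_one)
  then show ?thesis unfolding ga_powers_upto_def using assms(3,4)
    by (intro UN_I[of 1]) (auto intro!: exI[of _ "[p]"])
qed

section \<open>Partial permutation matrices\<close>

lemma mat_adjoint_index: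
  assumes "A \<in> carrier_mat d d" "i < d" "j < d"
  shows "mat_adjoint A $$ (i, j) = cnj (A $$ (j, i))"
  using assms by (simp add: mat_adjoint_def mat_of_rows_def)

lemma mat_adjoint_carrier: "A \<in> carrier_mat d d \<Longrightarrow> mat_adjoint A \<in> carrier_mat d d"
  by (auto simp: mat_adjoint_def mat_of_rows_def)

lemma mult_mat_index:
  assumes "A \<in> carrier_mat d d" "B \<in> carrier_mat d d" "i < d" "j < d"
  shows "(A * B) $$ (i, j) = (\<Sum>k<d. A $$ (i, k) * B $$ (k, j))"
  using assms by (simp add: scalar_prod_def lessThan_atLeast0)

lemma norm_2_eq:
  assumes A: "A \<in> carrier_mat d d"
  shows "norm_2 d A = sqrt ((\<Sum>(i, j)\<in>{..<d} \<times> {..<d}. (cmod (A $$ (i, j)))\<^sup>2) / real d)"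
proof -
  have "Re (cnj z * z) = (cmod z)\<^sup>2" for z
    unfolding cmod_power2 by (simp add: power2_eq_square)
  then have "Re (normalized_trace d (mat_adjoint A * A)) = (\<Sum>j<d. \<Sum>i<d. (cmod (A $$ (i, j)))\<^sup>2) / real d"
    unfolding normalized_trace_def
    by (simp add: mult_mat_index[OF mat_adjoint_carrier[OF A] A] mat_adjoint_index[OF A]
        Re_divide_of_nat Re_sum del: times_complex.sel)
  also have "(\<Sum>j<d. \<Sum>i<d. (cmod (A $$ (i, j)))\<^sup>2) = (\<Sum>i<d. \<Sum>j<d. (cmod (A $$ (i, j)))\<^sup>2)"
    by (rule sum.swap)
  also have "\<dots> = (\<Sum>(i, j)\<in>{..<d} \<times> {..<d}. (cmod (A $$ (i, j)))\<^sup>2)"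
    by (rule sum.cartesian_product)
  finally show ?thesis by (simp add: norm_2_def)
qed

lemma norm_2_nonneg: "A \<in> carrier_mat d d \<Longrightarrow> 0 \<le> norm_2 d A"
  by (auto simp: norm_2_eq intro!: sum_nonneg divide_nonneg_nonneg)

lemma norm_2_sq:
  assumes A: "A \<in> carrier_mat d d"
  shows "real d * (norm_2 d A)\<^sup>2 = (\<Sum>(i, j)\<in>{..<d} \<times> {..<d}. (cmod (A $$ (i, j)))\<^sup>2)"
proof -
  have "0 \<le> (\<Sum>(i, j)\<in>{..<d} \<times> {..<d}. (cmod (A $$ (i, j)))\<^sup>2) / real d"
    by (auto intro!: sum_nonneg divide_nonneg_nonneg)
  then show ?thesis by (cases "d = 0") (simp_all add: norm_2_eq[OF A])
qed

lemma Ints_norm_ge_1: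
  assumes "(z::complex) \<in> \<int>" "z \<noteq> 0"
  shows "1 \<le> cmod z"
  using assms by (auto elim!: Ints_cases)

text \<open>
  A nonzero integer has modulus at least 1, so on integer matrices the 2-norm controls the number of
  nonzero entries. Products of 0/1 matrices and their differences are integer matrices, and this
  turns each approximation in 2-norm into a count of entries.
\<close>

lemma card_nonzero_entries_le:
  assumes A: "A \<in> carrier_mat d d" and int: "\<And>i j. i < d \<Longrightarrow> j < d \<Longrightarrow> A $$ (i, j) \<in> \<int>"
  shows "real (card {(i, j) \<in> {..<d} \<times> {..<d}. A $$ (i, j) \<noteq> 0}) \<le> real d * (norm_2 d A)\<^sup>2"
proof -
  let ?N = "{(i, j) \<in> {..<d} \<times> {..<d}. A $$ (i, j) \<noteq> 0}"
  have "real (card ?N) = (\<Sum>(i, j)\<in>?N. 1)" by (simp add: case_prod_beta)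
  also have "\<dots> \<le> (\<Sum>(i, j)\<in>?N. (cmod (A $$ (i, j)))\<^sup>2)"
    using Ints_norm_ge_1[OF int] by (intro sum_mono) (auto simp: one_le_power)
  also have "\<dots> \<le> (\<Sum>(i, j)\<in>{..<d} \<times> {..<d}. (cmod (A $$ (i, j)))\<^sup>2)"
    by (intro sum_mono2) auto
  finally show ?thesis by (simp add: norm_2_sq[OF A])
qed

lemma partial_permutation_carrier: "A \<in> partial_permutation_mats d \<Longrightarrow> A \<in> carrier_mat d d"
  by (simp add: partial_permutation_mats_def)

lemma partial_permutation_entry:
  "A \<in> partial_permutation_mats d \<Longrightarrow> i < d \<Longrightarrow> j < d \<Longrightarrow> A $$ (i, j) = 0 \<or> A $$ (i, j) = 1"
  by (auto simp: partial_permutation_mats_def)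

text \<open>
  This is the entry \<open>(i, j)\<close> of \<open>A A\<^sup>* A = A\<close>. All terms on the left are nonnegative and the right
  side is at most 1; if the entry is a one, a second one in its row or column brings the left side
  to at least 2.
\<close>

lemma partial_permutation_cubic:
  assumes A: "A \<in> partial_permutation_mats d" and ij: "i < d" "j < d"
  shows "(\<Sum>l<d. \<Sum>k<d. Re (A $$ (i, k)) * Re (A $$ (l, k)) * Re (A $$ (l, j))) = Re (A $$ (i, j))"
proof -
  note C = partial_permutation_carrier[OF A] 
  note C' = mat_adjoint_carrier[OF C]
  have im: "Im (A $$ (i, j)) = 0" if "i < d" "j < d" for i j
    using partial_permutation_entry[OF A that] by auto
  have "A * mat_adjoint A * A = A"
    using A by (simp add: partial_permutation_mats_def partial_isometry_def)
  then have "Re (A $$ (i, j)) = Re ((A * mat_adjoint A * A) $$ (i, j))" by simp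
  also have "\<dots> = (\<Sum>l<d. \<Sum>k<d. Re (A $$ (i, k)) * Re (A $$ (l, k)) * Re (A $$ (l, j)))"
    using ij im
    by (simp add: mult_mat_index[OF mult_carrier_mat[OF C C'] C] mult_mat_index[OF C C']
        mat_adjoint_index[OF C] sum_distrib_right Im_sum)
  finally show ?thesis ..
qed

lemma partial_permutation_row_unique:
  assumes A: "A \<in> partial_permutation_mats d" and "i < d" "j < d" "k < d"
    and one: "A $$ (i, j) = 1" "A $$ (i, k) = 1"
  shows "j = k"
proof (rule ccontr)
  assume "j \<noteq> k"
  let ?a = "\<lambda>i j. Re (A $$ (i, j))"
  have nn: "0 \<le> ?a i j" if "i < d" "j < d" for i j using partial_permutation_entry[OF A that] by auto
  have "2 = (\<Sum>k'\<in>{j, k}. ?a i k' * ?a i k' * ?a i j)" using one \<open>j \<noteq> k\<close> by simp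
  also have "\<dots> \<le> (\<Sum>k'<d. ?a i k' * ?a i k' * ?a i j)"
    using assms nn by (intro sum_mono2) auto
  also have "\<dots> \<le> (\<Sum>l<d. \<Sum>k'<d. ?a i k' * ?a l k' * ?a l j)"
    using assms nn by (intro member_le_sum[of i "{..<d}" "\<lambda>l. \<Sum>k'<d. ?a i k' * ?a l k' * ?a l j"] sum_nonneg) auto
  also have "\<dots> = 1" using partial_permutation_cubic[OF A] assms by simp
  finally show False by simp
qed

lemma partial_permutation_column_unique:
  assumes A: "A \<in> partial_permutation_mats d" and "i < d" "j < d" "k < d"
    and one: "A $$ (j, i) = 1" "A $$ (k, i) = 1"
  shows "j = k"
proof (rule ccontr)
  assume "j \<noteq> k"
  let ?a = "\<lambda>i j. Re (A $$ (i, j))"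
  have nn: "0 \<le> ?a i j" if "i < d" "j < d" for i j using partial_permutation_entry[OF A that] by auto
  have "2 = (\<Sum>l\<in>{j, k}. ?a j i * ?a l i * ?a l i)" using one \<open>j \<noteq> k\<close> by simp
  also have "\<dots> \<le> (\<Sum>l<d. ?a j i * ?a l i * ?a l i)"
    using assms nn by (intro sum_mono2) auto
  also have "\<dots> \<le> (\<Sum>l<d. \<Sum>k'<d. ?a j k' * ?a l k' * ?a l i)"
    using assms nn
    by (intro sum_mono member_le_sum[of i "{..<d}" "\<lambda>k'. ?a j k' * ?a _ k' * ?a _ i"]) auto
  also have "\<dots> = 1" using partial_permutation_cubic[OF A] assms by simp
  finally show False by simp
qed

text \<open>
  A row of a partial permutation matrix is zero or given by the position of its only one, which
  leaves \<open>d + 1\<close> possibilities for each of the \<open>d\<close> rows.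
\<close>

lemma card_partial_permutation_mats_le:
  "finite (partial_permutation_mats d) \<and> card (partial_permutation_mats d) \<le> (d + 1) ^ d"
proof -
  \<comment> \<open>The value \<open>d\<close> marks a row without a one.\<close>
  define enc where "enc A = (\<lambda>i\<in>{..<d}. LEAST j. j = d \<or> A $$ (i, j) = (1::complex))" for A
  let ?P = "PiE {..<d} (\<lambda>_. {..d})"
  have enc: "j = enc A i \<longleftrightarrow> A $$ (i, j) = 1"
    if A: "A \<in> partial_permutation_mats d" and "i < d" "j < d" for A i j
  proof -
    have e: "enc A i = (LEAST j. j = d \<or> A $$ (i, j) = 1)" using that by (simp add: enc_def)
    have "enc A i = d \<or> A $$ (i, enc A i) = 1"
      unfolding e by (rule LeastI[of _ d]) simp
    moreover have "enc A i \<le> j" if "A $$ (i, j) = 1" 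
      unfolding e using that by (intro Least_le) simp
    ultimately show ?thesis using that partial_permutation_row_unique[OF A] by fastforce
  qed
  have "inj_on enc (partial_permutation_mats d)"
  proof (rule inj_onI)
    fix A B assume h: "A \<in> partial_permutation_mats d" "B \<in> partial_permutation_mats d" "enc A = enc B"
    show "A = B"
    proof (rule eq_matI)
      fix i j assume "i < dim_row B" "j < dim_col B"
      then have "i < d" "j < d" using partial_permutation_carrier[OF h(2)] by auto
      then show "A $$ (i, j) = B $$ (i, j)"
        using enc[OF h(1)] enc[OF h(2)] h(3) partial_permutation_entry[OF h(1)] partial_permutation_entry[OF h(2)] by metis
    qed (use partial_permutation_carrier[OF h(1)] partial_permutation_carrier[OF h(2)] in auto)
  qed
  moreover have "enc ` partial_permutation_mats d \<subseteq> ?P"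
    by (force simp: enc_def restrict_PiE_iff intro: Least_le)
  moreover have "finite ?P" by (simp add: finite_PiE)
  moreover have "card ?P = (d + 1) ^ d" by (simp add: card_PiE)
  ultimately show ?thesis by (metis card_inj_on_le inj_on_finite)
qed

lemma one_partial_permutation: "1\<^sub>m d \<in> partial_permutation_mats d"
proof -
  have "mat_adjoint (1\<^sub>m d) = (1\<^sub>m d :: complex mat)"
    by (rule eq_matI) (simp_all add: mat_adjoint_def mat_of_rows_def)
  then show ?thesis by (simp add: partial_permutation_mats_def partial_isometry_def)
qed

lemma card_ones_in_columns_le:
  assumes A: "A \<in> partial_permutation_mats d" and "finite D"
  shows "card {(i, j) \<in> {..<d} \<times> {..<d}. j \<in> D \<and> A $$ (i, j) = 1} \<le> card D"
    and "card {(i, j) \<in> {..<d} \<times> {..<d}. j \<in> D \<and> A $$ (j, i) = 1} \<le> card D"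
proof -
  show "card {(i, j) \<in> {..<d} \<times> {..<d}. j \<in> D \<and> A $$ (i, j) = 1} \<le> card D"
    using partial_permutation_column_unique[OF A] assms(2) by (intro card_inj_on_le[of snd]) (auto simp: inj_on_def)
  show "card {(i, j) \<in> {..<d} \<times> {..<d}. j \<in> D \<and> A $$ (j, i) = 1} \<le> card D"
    using partial_permutation_row_unique[OF A] assms(2) by (intro card_inj_on_le[of snd]) (auto simp: inj_on_def)
qed

text \<open>
  If \<open>A B\<close> has a one at \<open>(j, j)\<close>, then row \<open>j\<close> of \<open>A\<close> and column \<open>j\<close> of \<open>B\<close> have their only one at the
  same index, so column \<open>j\<close> of \<open>B\<close> agrees with that of the transpose of \<open>A\<close>. In any other column each
  of the two matrices has at most one nonzero entry. So a nearly full trace of \<open>A B\<close> makes \<open>B\<close> nearly the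
  transpose of \<open>A\<close>; for \<open>A = 1\<close>, a partial permutation matrix of nearly full trace is nearly \<open>1\<close>.
\<close>

lemma card_diff_transpose_le:
  assumes A: "A \<in> partial_permutation_mats d" and B: "B \<in> partial_permutation_mats d"
  shows "card {(i, j) \<in> {..<d} \<times> {..<d}. B $$ (i, j) \<noteq> A $$ (j, i)}
    \<le> 2 * card {i \<in> {..<d}. (A * B) $$ (i, i) \<noteq> 1}"
proof -
  let ?D = "{i \<in> {..<d}. (A * B) $$ (i, i) \<noteq> 1}"
  let ?X = "{(i, j) \<in> {..<d} \<times> {..<d}. j \<in> ?D \<and> B $$ (i, j) = 1}"
  let ?Y = "{(i, j) \<in> {..<d} \<times> {..<d}. j \<in> ?D \<and> A $$ (j, i) = 1}"
  have good: "B $$ (i, j) = A $$ (j, i)" if "i < d" "j < d" "(A * B) $$ (j, j) = 1" for i j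
  proof -
    have "(\<Sum>k<d. A $$ (j, k) * B $$ (k, j)) \<noteq> 0"
      using that mult_mat_index[OF partial_permutation_carrier[OF A] partial_permutation_carrier[OF B]] by auto
    then obtain k where k: "k < d" "A $$ (j, k) * B $$ (k, j) \<noteq> 0"
      by (meson lessThan_iff sum.not_neutral_contains_not_neutral)
    then have "A $$ (j, k) = 1" "B $$ (k, j) = 1"
      using partial_permutation_entry[OF A, of j k] partial_permutation_entry[OF B, of k j] that by auto
    then show ?thesis
      using partial_permutation_entry[OF A, of j i] partial_permutation_entry[OF B, of i j] that k
        partial_permutation_row_unique[OF A, of j i k] partial_permutation_column_unique[OF B, of j i k] by auto
  qed
  have "j \<in> ?D \<and> (B $$ (i, j) = 1 \<or> A $$ (j, i) = 1)"
    if ij: "i < d" "j < d" "B $$ (i, j) \<noteq> A $$ (j, i)" for i j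
    using ij good[OF ij(1,2)] partial_permutation_entry[OF A ij(2,1)] partial_permutation_entry[OF B ij(1,2)] by auto
  then have "{(i, j) \<in> {..<d} \<times> {..<d}. B $$ (i, j) \<noteq> A $$ (j, i)} \<subseteq> ?X \<union> ?Y"
    by blast
  then have "card {(i, j) \<in> {..<d} \<times> {..<d}. B $$ (i, j) \<noteq> A $$ (j, i)} \<le> card (?X \<union> ?Y)"
    by (intro card_mono) (auto intro: finite_subset[of _ "{..<d} \<times> {..<d}"])
  also have "\<dots> \<le> card ?X + card ?Y" by (rule card_Un_le)
  also have "card ?X \<le> card ?D" by (rule card_ones_in_columns_le[OF B]) auto
  also have "card ?Y \<le> card ?D" by (rule card_ones_in_columns_le[OF A]) auto
  finally show ?thesis by simp
qed

text \<open>
  The real part of \<open>1 - tr A\<close> is the proportion of zeros on the diagonal.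
\<close>

lemma card_diag_le:
  assumes A: "A \<in> partial_permutation_mats d" and tr: "cmod (normalized_trace d A - 1) < \<delta>" and d: "0 < d"
  shows "real (card {i \<in> {..<d}. A $$ (i, i) \<noteq> 1}) \<le> \<delta> * real d"
proof -
  let ?D = "{i \<in> {..<d}. A $$ (i, i) \<noteq> 1}"
  have "Re (A $$ (i, i)) = (if i \<in> ?D then 0 else 1)" if "i < d" for i
    using partial_permutation_entry[OF A that that] that by auto
  then have "Re (\<Sum>i<d. A $$ (i, i)) = (\<Sum>i<d. if i \<in> ?D then 0 else 1)" by simp
  also have "\<dots> = real (card ({..<d} - ?D))"
    by (subst sum.If_cases) (auto simp: Diff_eq intro!: arg_cong[where f = card])
  also have "\<dots> = real d - real (card ?D)"
  proof -
    have "card ?D \<le> d" using card_mono[of "{..<d}" ?D] by auto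
    then show ?thesis by (subst card_Diff_subset) (auto simp: of_nat_diff)
  qed
  finally have sum: "Re (\<Sum>i<d. A $$ (i, i)) = real d - real (card ?D)" .
  have "Re (normalized_trace d A - 1) = Re (\<Sum>i<d. A $$ (i, i)) / real d - 1"
    by (simp add: normalized_trace_def Re_divide_of_nat)
  also have "\<dots> = - real (card ?D) / real d"
    unfolding sum using d by (simp add: field_simps)
  finally have "Re (normalized_trace d A - 1) = - real (card ?D) / real d" .
  then have "real (card ?D) / real d \<le> \<delta>"
    using abs_Re_le_cmod[of "normalized_trace d A - 1"] tr by simp
  then show ?thesis using d by (simp add: field_simps)
qed

section \<open>Counting sofic approximations through their defects\<close>

text \<open>
  Such a set arises from the empty set in \<open>K\<close> steps, each of which adds a point or does nothing. The
  crude bound is good enough: for \<open>card U = O(d\<^sup>2)\<close> and \<open>K = O(\<delta> d)\<close> its logarithm is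
  \<open>O(\<delta> d log d)\<close>.
\<close>

lemma card_small_subsets:
  assumes "finite U"
  shows "card {S. S \<subseteq> U \<and> card S \<le> K} \<le> (card U + 1) ^ K"
proof (induction K)
  case 0
  have "{S. S \<subseteq> U \<and> card S \<le> 0} = {{}}"
    using assms finite_subset by fastforce
  then show ?case by simp
next
  case (Suc K)
  let ?S = "\<lambda>K. {S. S \<subseteq> U \<and> card S \<le> K}"
  let ?add = "\<lambda>(S, z). case z of None \<Rightarrow> S | Some u \<Rightarrow> insert u S"
  let ?O = "insert None (Some ` U)"
  have fin: "finite (?S K \<times> ?O)" using assms by simp
  have "?S (Suc K) \<subseteq> ?add ` (?S K \<times> ?O)"
  proof
    fix S assume S: "S \<in> ?S (Suc K)"
    then have "finite S" using assms finite_subset by auto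
    show "S \<in> ?add ` (?S K \<times> ?O)"
    proof (cases "S = {}")
      case True
      then show ?thesis by (intro image_eqI[of _ _ "({}, None)"]) auto
    next
      case False
      then obtain u where u: "u \<in> S" by auto
      then have "card (S - {u}) \<le> K" using S \<open>finite S\<close> by auto
      then show ?thesis
        using S u by (intro image_eqI[of _ _ "(S - {u}, Some u)"]) auto
    qed
  qed
  then have "card (?S (Suc K)) \<le> card (?S K \<times> ?O)"
    using fin by (rule surj_card_le[rotated])
  also have "\<dots> = card (?S K) * (card U + 1)"
    using assms by (simp add: card_cartesian_product card_image)
  also have "\<dots> \<le> (card U + 1) ^ K * (card U + 1)" using Suc by (rule mult_le_mono1)
  also have "\<dots> = (card U + 1) ^ Suc K" by simp
  finally show ?case .
qed

lemma card_image_le_of_factor: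
  assumes "finite (g ` A)" and "\<And>x y. x \<in> A \<Longrightarrow> y \<in> A \<Longrightarrow> g x = g y \<Longrightarrow> f x = f y"
  shows "finite (f ` A) \<and> card (f ` A) \<le> card (g ` A)"
proof -
  have "f x = f (SOME y. y \<in> A \<and> g y = g x)" if "x \<in> A" for x
    using that someI[of "\<lambda>y. y \<in> A \<and> g y = g x" x] by (intro assms(2)) auto
  then have eq: "f ` A = (\<lambda>z. f (SOME y. y \<in> A \<and> g y = z)) ` (g ` A)"
    unfolding image_image by (intro image_cong) auto
  show ?thesis unfolding eq by (intro conjI finite_imageI card_image_le assms(1))
qed

text \<open>
  The values of \<open>A\<close> are recorded along with the positions, so that \<open>A\<close> can be recovered from this set and
  \<open>P\<close> for any complex matrix \<open>P\<close>.
\<close>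

definition diff_entries :: "nat \<Rightarrow> complex mat \<Rightarrow> complex mat \<Rightarrow> (nat \<times> nat \<times> complex) set" where
  "diff_entries d A P = {(i, j, A $$ (i, j)) | i j. i < d \<and> j < d \<and> A $$ (i, j) \<noteq> P $$ (i, j)}"

lemma diff_entries_eq_imp_eq:
  assumes "A \<in> carrier_mat d d" "B \<in> carrier_mat d d" "diff_entries d A P = diff_entries d B P"
  shows "A = B"
proof (rule eq_matI)
  fix i j assume ij: "i < dim_row B" "j < dim_col B"
  have mem: "(i, j, v) \<in> diff_entries d M P \<longleftrightarrow> v = M $$ (i, j) \<and> v \<noteq> P $$ (i, j)" for M v
    using ij assms(2) by (auto simp: diff_entries_def)
  show "A $$ (i, j) = B $$ (i, j)" using mem[of _ A] mem[of _ B] assms(3) by metis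
qed (use assms in auto)

lemma diff_entries_subset:
  assumes "A \<in> partial_permutation_mats d"
  shows "diff_entries d A P \<subseteq> {..<d} \<times> {..<d} \<times> {0, 1}"
  using partial_permutation_entry[OF assms] by (auto simp: diff_entries_def)

lemma card_diff_entries:
  "card (diff_entries d A P) \<le> card {(i, j) \<in> {..<d} \<times> {..<d}. A $$ (i, j) \<noteq> P $$ (i, j)}"
proof -
  have "diff_entries d A P = (\<lambda>(i, j). (i, j, A $$ (i, j))) ` {(i, j) \<in> {..<d} \<times> {..<d}. A $$ (i, j) \<noteq> P $$ (i, j)}"
    by (auto simp: diff_entries_def image_iff)
  moreover have "finite {(i, j) \<in> {..<d} \<times> {..<d}. A $$ (i, j) \<noteq> P $$ (i, j)}"
    by (rule finite_subset[of _ "{..<d} \<times> {..<d}"]) auto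
  ultimately show ?thesis by (simp add: card_image_le)
qed

text \<open>
  An approximate value of \<open>\<phi>\<close> at a word, computed from its values at generators and at shorter words.
  A generator predicts itself: its value is stored in full when \<open>\<phi>\<close> is encoded. For the inverse of a
  generator the prediction is the adjoint of the value at the generator.
\<close>

fun predicted :: "nat \<Rightarrow> ((('i \<times> bool) list \<Rightarrow>\<^sub>0 complex) \<Rightarrow> complex mat) \<Rightarrow> ('i \<times> bool) list \<Rightarrow> complex mat"
where
  "predicted d \<phi> [] = 1\<^sub>m d"
| "predicted d \<phi> [x] = (if snd x then \<phi> (ga_of [x]) else transpose_mat (\<phi> (ga_of [(fst x, True)])))"
| "predicted d \<phi> (x # y # w) = \<phi> (ga_of [x]) * \<phi> (ga_of (y # w))"

text \<open>
  For the upper bound products of two elements of \<open>F\<close> suffice, since \<open>F\<close> will contain all words up to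
  some length.
\<close>

lemma SA_two_properties:
  fixes \<phi> :: "('g \<Rightarrow>\<^sub>0 complex) \<Rightarrow> complex mat"
  assumes G: "group G" and F: "F \<subseteq> I_group G" and \<phi>: "\<phi> \<in> SA G F 2 \<delta> d"
  shows "p \<in> F \<Longrightarrow> \<phi> p \<in> partial_permutation_mats d"
    and "p \<in> F \<Longrightarrow> cmod (normalized_trace d (\<phi> p) - ga_trace G p) < \<delta>"
    and "p \<in> F \<Longrightarrow> q \<in> F \<Longrightarrow> norm_2 d (\<phi> (ga_mult G p q) - \<phi> p * \<phi> q) < \<delta>"
    and "\<phi> 0 = 0\<^sub>m d d"
proof -
  let ?S = "F \<union> ga_star G ` F"
  have S: "?S \<subseteq> I_group G" using F I_group_star[OF G] by blast
  have \<phi>': "\<forall>k\<in>{1..2}. \<forall>ss. length ss = k \<and> set ss \<subseteq> ?S \<longrightarrow>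
           norm_2 d (\<phi> (ga_prod G ss) - mat_prod d (map \<phi> ss)) < \<delta>"
    "\<phi> ` ga_powers_upto G ?S 2 \<subseteq> partial_permutation_mats d"
    "\<forall>s\<in>ga_powers_upto G ?S 2. cmod (normalized_trace d (\<phi> s) - ga_trace G s) < \<delta>"
    and lin: "\<phi> \<in> linear_to_mats G d"
    using \<phi> unfolding SA_def Let_def by auto
  have one: "p \<in> ga_powers_upto G ?S 2" if "p \<in> F" for p
    using that by (intro ga_powers_upto_single[OF G S]) auto
  show pp: "p \<in> F \<Longrightarrow> \<phi> p \<in> partial_permutation_mats d" for p
    using one \<phi>'(2) by blast
  show "p \<in> F \<Longrightarrow> cmod (normalized_trace d (\<phi> p) - ga_trace G p) < \<delta>"
    using one \<phi>'(3) by blast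
  show "norm_2 d (\<phi> (ga_mult G p q) - \<phi> p * \<phi> q) < \<delta>" if "p \<in> F" "q \<in> F"
  proof -
    have "ga_prod G [p, q] = ga_mult G p q"
      using that F by (auto simp: ga_prod_def intro!: ga_mult_one[OF G] arg_cong[where f = "ga_mult G p"])
    moreover have "mat_prod d (map \<phi> [p, q]) = \<phi> p * \<phi> q"
      using partial_permutation_carrier[OF pp[OF that(2)]] by (simp add: mat_prod_def)
    moreover have "norm_2 d (\<phi> (ga_prod G [p, q]) - mat_prod d (map \<phi> [p, q])) < \<delta>"
      by (rule \<phi>'(1)[rule_format, of 2]) (use that in auto)
    ultimately show ?thesis by simp
  qed
  have c: "p \<in> group_alg G \<Longrightarrow> \<phi> p \<in> carrier_mat d d" for p
    using lin by (simp add: linear_to_mats_def)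
  have 0: "0 \<in> group_alg G" by (simp add: group_alg_def)
  have "\<phi> (ga_smult 0 0) = 0 \<cdot>\<^sub>m \<phi> 0" using lin 0 by (simp add: linear_to_mats_def)
  moreover have "ga_smult 0 0 = (0 :: 'g \<Rightarrow>\<^sub>0 complex)" by (rule poly_mapping_eqI) (simp add: ga_smult_def Poly_Mapping.map.rep_eq)
  ultimately have "\<phi> 0 = 0 \<cdot>\<^sub>m \<phi> 0" by simp
  also have "\<dots> = 0\<^sub>m d d" using c[OF 0] by (intro eq_matI) auto
  finally show "\<phi> 0 = 0\<^sub>m d d" .
qed

definition short_words :: "'i set \<Rightarrow> nat \<Rightarrow> ('i \<times> bool) list set" where
  "short_words I m = {w \<in> carrier (free_group I). length w \<le> m}"

lemma finite_short_words: "finite I \<Longrightarrow> finite (short_words I m)"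
  by (rule finite_subset[OF _ finite_lists_length_le[of "I \<times> UNIV" m]])
    (auto simp: short_words_def free_group_def)

lemma ga_of_short_words_I_group: "ga_of ` short_words I m \<subseteq> I_group (free_group I)"
  by (auto simp: short_words_def I_group_def)

lemma mult_words_card_le:
  fixes \<delta> :: real
  assumes \<phi>: "\<phi> \<in> SA (free_group I) (ga_of ` short_words I m) 2 \<delta> d"
    and uv: "u \<in> short_words I m" "v \<in> short_words I m"
      "u \<otimes>\<^bsub>free_group I\<^esub> v \<in> short_words I m"
    and \<delta>: "0 < \<delta>" "\<delta> \<le> 1"
  shows "real (card {(i, j) \<in> {..<d} \<times> {..<d}. \<phi> (ga_of (u \<otimes>\<^bsub>free_group I\<^esub> v)) $$ (i, j)
            \<noteq> (\<phi> (ga_of u) * \<phi> (ga_of v)) $$ (i, j)}) \<le> \<delta> * real d"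
proof -
  let ?G = "free_group I"
  note D = SA_two_properties[OF group_free_group ga_of_short_words_I_group \<phi>]
  let ?A = "\<phi> (ga_of u)" and ?B = "\<phi> (ga_of v)" and ?C = "\<phi> (ga_of (u \<otimes>\<^bsub>?G\<^esub> v))"
  have pp: "?A \<in> partial_permutation_mats d" "?B \<in> partial_permutation_mats d"
    "?C \<in> partial_permutation_mats d" using D(1) uv by auto
  note carr = pp[THEN partial_permutation_carrier]
  have AB: "?A * ?B \<in> carrier_mat d d" using carr by simp
  have diff: "?C - ?A * ?B \<in> carrier_mat d d" by (rule minus_carrier_mat[OF AB])
  have pp_Ints: "M $$ (i, j) \<in> \<int>" if "M \<in> partial_permutation_mats d" "i < d" "j < d" for M i j
    using partial_permutation_entry[OF that] by auto
  have "(?C - ?A * ?B) $$ (i, j) \<in> \<int>" if ij: "i < d" "j < d" for i j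
  proof -
    have "(?A * ?B) $$ (i, j) \<in> \<int>"
      unfolding mult_mat_index[OF carr(1,2) ij]
      using ij pp by (intro Ints_sum Ints_mult pp_Ints) auto
    then have "?C $$ (i, j) - (?A * ?B) $$ (i, j) \<in> \<int>"
      using pp_Ints[OF pp(3) ij] by (rule Ints_diff[rotated])
    then show ?thesis using ij AB carr by simp
  qed
  note card_nonzero_entries_le[OF diff this]
  moreover have "{(i, j) \<in> {..<d} \<times> {..<d}. (?C - ?A * ?B) $$ (i, j) \<noteq> 0} =
      {(i, j) \<in> {..<d} \<times> {..<d}. ?C $$ (i, j) \<noteq> (?A * ?B) $$ (i, j)}"
    using AB carr by auto
  moreover have "(norm_2 d (?C - ?A * ?B))\<^sup>2 \<le> \<delta>"
  proof -
    have "norm_2 d (?C - ?A * ?B) < \<delta>"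
      using D(3)[of "ga_of u" "ga_of v"] uv by (simp add: ga_mult_ga_of)
    moreover have "0 \<le> norm_2 d (?C - ?A * ?B)" by (rule norm_2_nonneg[OF diff])
    ultimately have "(norm_2 d (?C - ?A * ?B))\<^sup>2 \<le> \<delta>\<^sup>2" by (intro power_mono) auto
    also have "\<dots> \<le> \<delta>" using \<delta> by (simp add: power2_eq_square mult_left_le)
    finally show ?thesis .
  qed
  ultimately show ?thesis by (smt (verit) mult.commute mult_left_mono of_nat_0_le_iff)
qed

text \<open>
  At the empty word the trace condition applies, and \<open>\<phi>(e)\<close> has at most \<open>\<delta> d\<close> zeros on its diagonal.
  Since \<open>\<phi>(x) \<phi>(x\<^sup>-\<^sup>1)\<close> differs from \<open>\<phi>(e)\<close> in at most \<open>\<delta> d\<close> entries, its diagonal has at most \<open>2 \<delta> d\<close>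
  entries other than one, which makes \<open>\<phi>(x\<^sup>-\<^sup>1)\<close> close to the transpose of \<open>\<phi>(x)\<close>. Longer words
  are products of two shorter ones.
\<close>

lemma card_diff_predicted:
  fixes \<delta> :: real
  assumes \<phi>: "\<phi> \<in> SA (free_group I) (ga_of ` short_words I m) 2 \<delta> d"
    and w: "w \<in> short_words I m"
    and \<delta>: "0 < \<delta>" "\<delta> \<le> 1" and d: "0 < d" and m: "1 \<le> m"
  shows "real (card (diff_entries d (\<phi> (ga_of w)) (predicted d \<phi> w))) \<le> 4 * \<delta> * real d"
proof -
  let ?G = "free_group I"
  note D = SA_two_properties[OF group_free_group ga_of_short_words_I_group \<phi>]
  note mult_le = mult_words_card_le[OF \<phi> _ _ _ \<delta>]
  let ?E = "\<phi> (ga_of [])"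
  let ?bad = "{i \<in> {..<d}. ?E $$ (i, i) \<noteq> 1}"
  have nil: "[] \<in> short_words I m" by (simp add: short_words_def free_group_def reduced_def)
  then have E: "?E \<in> partial_permutation_mats d" using D(1) by auto
  have "cmod (normalized_trace d ?E - 1) < \<delta>"
    using D(2)[of "ga_of []"] nil by (auto simp: ga_trace_def ga_of_def free_group_def)
  then have bad: "real (card ?bad) \<le> \<delta> * real d" by (rule card_diag_le[OF E _ d])
  consider "w = []" | i where "w = [(i, True)]" | i where "w = [(i, False)]" | x y u where "w = x # y # u"
    by (metis (full_types) list.exhaust surj_pair)
  then show ?thesis
  proof cases
    case 1
    have eq: "(1\<^sub>m d * ?E) = ?E" using partial_permutation_carrier[OF E] by simp
    have "card (diff_entries d ?E (1\<^sub>m d)) \<le> card {(i, j) \<in> {..<d} \<times> {..<d}. ?E $$ (i, j) \<noteq> 1\<^sub>m d $$ (i, j)}"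
      by (rule card_diff_entries)
    also have "\<dots> = card {(i, j) \<in> {..<d} \<times> {..<d}. ?E $$ (i, j) \<noteq> 1\<^sub>m d $$ (j, i)}"
      by (intro arg_cong[where f = card] Collect_cong) (auto simp: eq_commute)
    also have "\<dots> \<le> 2 * card ?bad"
      using card_diff_transpose_le[OF one_partial_permutation E] by (simp add: eq)
    finally show ?thesis using bad 1 by simp
  next
    case 2
    then show ?thesis using \<delta> by (simp add: diff_entries_def)
  next
    case (3 i)
    let ?A = "\<phi> (ga_of [(i, True)])" and ?B = "\<phi> (ga_of [(i, False)])"
    let ?N = "{(i, j) \<in> {..<d} \<times> {..<d}. ?E $$ (i, j) \<noteq> (?A * ?B) $$ (i, j)}"
    have mem: "[(i, True)] \<in> short_words I m" "[(i, False)] \<in> short_words I m"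
      using w m 3 by (auto simp: short_words_def free_group_def reduced_def)
    have mult: "[(i, True)] \<otimes>\<^bsub>?G\<^esub> [(i, False)] = []"
      by (simp add: free_group_def cancelling_def)
    have N: "real (card ?N) \<le> \<delta> * real d"
      using mult_le[OF mem] nil unfolding mult by simp
    have pp: "?A \<in> partial_permutation_mats d" "?B \<in> partial_permutation_mats d"
      using D(1) mem by auto
    have finN: "finite ?N" by (rule finite_subset[of _ "{..<d} \<times> {..<d}"]) auto
    have "{j \<in> {..<d}. (?A * ?B) $$ (j, j) \<noteq> 1} \<subseteq> ?bad \<union> fst ` ?N"
      by (force simp: image_iff)
    then have "card {j \<in> {..<d}. (?A * ?B) $$ (j, j) \<noteq> 1} \<le> card (?bad \<union> fst ` ?N)"
      using finN by (intro card_mono) auto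
    also have "\<dots> \<le> card ?bad + card ?N"
      using card_Un_le[of ?bad "fst ` ?N"] card_image_le[OF finN, of fst] by linarith
    finally have "real (card {j \<in> {..<d}. (?A * ?B) $$ (j, j) \<noteq> 1}) \<le> 2 * \<delta> * real d"
      using bad N by simp
    moreover have "card (diff_entries d ?B (transpose_mat ?A))
      \<le> card {(i, j) \<in> {..<d} \<times> {..<d}. ?B $$ (i, j) \<noteq> ?A $$ (j, i)}"
    proof -
      have "{(i, j) \<in> {..<d} \<times> {..<d}. ?B $$ (i, j) \<noteq> transpose_mat ?A $$ (i, j)} =
        {(i, j) \<in> {..<d} \<times> {..<d}. ?B $$ (i, j) \<noteq> ?A $$ (j, i)}"
        using partial_permutation_carrier[OF pp(1)] by auto
      then show ?thesis using card_diff_entries[of d ?B "transpose_mat ?A"] by simp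
    qed
    ultimately show ?thesis using card_diff_transpose_le[OF pp] 3 by simp
  next
    case (4 x y u)
    have mem: "[x] \<in> short_words I m" "y # u \<in> short_words I m"
      using w m 4 by (auto simp: short_words_def free_group_def reduced_def)
    have mult: "[x] \<otimes>\<^bsub>?G\<^esub> (y # u) = w"
      using w 4 by (simp add: short_words_def free_group_def reduced_def)
    have "card (diff_entries d (\<phi> (ga_of w)) (predicted d \<phi> w)) \<le>
      card {(i, j) \<in> {..<d} \<times> {..<d}. \<phi> (ga_of w) $$ (i, j) \<noteq> (\<phi> (ga_of [x]) * \<phi> (ga_of (y # u))) $$ (i, j)}"
      using card_diff_entries[of d "\<phi> (ga_of w)"] 4 by simp
    moreover have "real (card {(i, j) \<in> {..<d} \<times> {..<d}. \<phi> (ga_of w) $$ (i, j) \<noteq> (\<phi> (ga_of [x]) * \<phi> (ga_of (y # u))) $$ (i, j)})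
      \<le> \<delta> * real d"
      using mult_le[OF mem] w unfolding mult by simp
    moreover have "\<delta> * real d \<le> 4 * \<delta> * real d" using \<delta> by simp
    ultimately show ?thesis by linarith
  qed
qed

text \<open>
  Predictions refer to generators and shorter words only, so the values can be reconstructed by
  induction on the length.
\<close>

lemma equal_on_short_words:
  assumes "\<And>w. w \<in> short_words I m \<Longrightarrow> \<phi> (ga_of w) \<in> carrier_mat d d \<and> \<psi> (ga_of w) \<in> carrier_mat d d"
    and gens: "\<And>i. i \<in> I \<Longrightarrow> \<phi> (ga_of [(i, True)]) = \<psi> (ga_of [(i, True)])"
    and diff: "\<And>w. w \<in> short_words I m \<Longrightarrow> diff_entries d (\<phi> (ga_of w)) (predicted d \<phi> w)
       = diff_entries d (\<psi> (ga_of w)) (predicted d \<psi> w)"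
  shows "w \<in> short_words I m \<Longrightarrow> \<phi> (ga_of w) = \<psi> (ga_of w)"
proof (induction "length w" arbitrary: w rule: less_induct)
  case less
  have "predicted d \<phi> w = predicted d \<psi> w"
  proof -
    consider "w = []" | i b where "w = [(i, b)]" | x y u where "w = x # y # u"
      by (metis list.exhaust surj_pair)
    then show ?thesis
    proof cases
      case 2
      then have "i \<in> I" using less.prems by (auto simp: short_words_def free_group_def)
      then show ?thesis using 2 gens by (cases b) auto
    next
      case (3 x y u)
      have mem: "[x] \<in> short_words I m" "y # u \<in> short_words I m"
        using less.prems 3 by (auto simp: short_words_def free_group_def reduced_def)
      then have "\<phi> (ga_of [x]) = \<psi> (ga_of [x])" "\<phi> (ga_of (y # u)) = \<psi> (ga_of (y # u))"
        using less.hyps 3 by simp_all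
      then show ?thesis using 3 by simp
    qed simp
  qed
  then show ?case
    using assms(1)[OF less.prems] diff[OF less.prems] by (intro diff_entries_eq_imp_eq) auto
qed

text \<open>
  An approximation is encoded by its values at the generators and its defects against the
  predictions at all short words. The values at the generators give the main factor, with logarithm
  about \<open>card I\<close> times \<open>d log d\<close>; the defects are sets of at most \<open>4 \<delta> d\<close> entries.
\<close>

lemma card_restrictions_le:
  fixes I :: "'i set" and \<delta> :: real and E :: "(('i \<times> bool) list \<Rightarrow>\<^sub>0 complex) set"
  assumes I: "finite I" and E: "E \<subseteq> insert 0 (ga_of ` short_words I m)"
    and \<delta>: "0 < \<delta>" "\<delta> \<le> 1" and d: "0 < d" and m: "1 \<le> m"
  defines "A \<equiv> SA (free_group I) (ga_of ` short_words I m) 2 \<delta> d"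
    and "K \<equiv> nat \<lfloor>4 * \<delta> * real d\<rfloor>"
  shows "finite ((\<lambda>\<phi>. restrict \<phi> E) ` A) \<and>
    card ((\<lambda>\<phi>. restrict \<phi> E) ` A)
      \<le> ((d + 1) ^ d) ^ card I * ((2 * d\<^sup>2 + 1) ^ K) ^ card (short_words I m)"
proof -
  let ?W = "short_words I m"
  let ?U = "{..<d} \<times> {..<d} \<times> {0, 1 :: complex}"
  let ?S = "{S. S \<subseteq> ?U \<and> card S \<le> K}"
  let ?C = "PiE I (\<lambda>_. partial_permutation_mats d) \<times> PiE ?W (\<lambda>_. ?S)"
  define code where "code \<phi> = (\<lambda>i\<in>I. \<phi> (ga_of [(i, True)]),
      \<lambda>w\<in>?W. diff_entries d (\<phi> (ga_of w)) (predicted d \<phi> w))" 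
    for \<phi> :: "(('i \<times> bool) list \<Rightarrow>\<^sub>0 complex) \<Rightarrow> complex mat"
  note D = SA_two_properties[OF group_free_group ga_of_short_words_I_group, of _ I m \<delta> d, folded A_def]
  have finW: "finite ?W" using I by (rule finite_short_words)
  have gen: "[(i, True)] \<in> ?W" if "i \<in> I" for i
    using that m by (auto simp: short_words_def free_group_def reduced_def)
  have cU: "card ?U = 2 * d\<^sup>2" by (simp add: card_cartesian_product power2_eq_square)
  have finS: "finite ?S" by simp
  have cS: "card ?S \<le> (2 * d\<^sup>2 + 1) ^ K"
    using card_small_subsets[of ?U K] unfolding cU by simp
  have finC: "finite ?C"
    using I finW finS card_partial_permutation_mats_le[of d] by (intro finite_cartesian_product finite_PiE) auto
  have sub: "code ` A \<subseteq> ?C"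
  proof
    fix z assume "z \<in> code ` A"
    then obtain \<phi> where \<phi>: "\<phi> \<in> A" and z: "z = code \<phi>" by auto
    have "diff_entries d (\<phi> (ga_of w)) (predicted d \<phi> w) \<in> ?S" if w: "w \<in> ?W" for w
    proof -
      have "\<phi> (ga_of w) \<in> partial_permutation_mats d" using D(1)[OF \<phi>] w by blast
      then have "diff_entries d (\<phi> (ga_of w)) (predicted d \<phi> w) \<subseteq> ?U"
        by (rule diff_entries_subset)
      moreover have "real (card (diff_entries d (\<phi> (ga_of w)) (predicted d \<phi> w))) \<le> 4 * \<delta> * real d"
        using \<phi> unfolding A_def by (rule card_diff_predicted[OF _ w \<delta> d m])
      ultimately show ?thesis unfolding K_def by (simp add: le_nat_floor)
    qed
    moreover have "\<phi> (ga_of [(i, True)]) \<in> partial_permutation_mats d" if "i \<in> I" for i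
      using D(1)[OF \<phi>] gen[OF that] by blast
    ultimately show "z \<in> ?C" unfolding z code_def by (simp add: restrict_PiE_iff)
  qed
  have det: "restrict \<phi> E = restrict \<psi> E" if h: "\<phi> \<in> A" "\<psi> \<in> A" "code \<phi> = code \<psi>" for \<phi> \<psi>
  proof -
    have c: "(\<lambda>i\<in>I. \<phi> (ga_of [(i, True)])) = (\<lambda>i\<in>I. \<psi> (ga_of [(i, True)]))"
      "(\<lambda>w\<in>?W. diff_entries d (\<phi> (ga_of w)) (predicted d \<phi> w)) =
       (\<lambda>w\<in>?W. diff_entries d (\<psi> (ga_of w)) (predicted d \<psi> w))"
      using h(3) by (simp_all add: code_def)
    have "\<phi> (ga_of w) = \<psi> (ga_of w)" if w: "w \<in> ?W" for w
    proof (rule equal_on_short_words[OF _ _ _ w, of \<phi> d \<psi>])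
      show "\<phi> (ga_of v) \<in> carrier_mat d d \<and> \<psi> (ga_of v) \<in> carrier_mat d d" if "v \<in> ?W" for v
        using D(1)[OF h(1)] D(1)[OF h(2)] that partial_permutation_carrier by blast
      show "\<phi> (ga_of [(i, True)]) = \<psi> (ga_of [(i, True)])" if "i \<in> I" for i
        using fun_cong[OF c(1), of i] that by simp
      show "diff_entries d (\<phi> (ga_of v)) (predicted d \<phi> v) =
          diff_entries d (\<psi> (ga_of v)) (predicted d \<psi> v)" if "v \<in> ?W" for v
        using fun_cong[OF c(2), of v] that by simp
    qed
    moreover have "\<phi> 0 = \<psi> 0" using D(4)[OF h(1)] D(4)[OF h(2)] by simp
    ultimately show ?thesis using E by (intro restrict_ext) auto
  qed
  have fin_code: "finite (code ` A)" using sub finC by (rule finite_subset)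
  have "card (code ` A) \<le> card ?C" using finC sub by (rule card_mono)
  also have "\<dots> = card (partial_permutation_mats d) ^ card I * card ?S ^ card ?W"
    using I finW by (simp add: card_cartesian_product card_PiE)
  also have "\<dots> \<le> ((d + 1) ^ d) ^ card I * ((2 * d\<^sup>2 + 1) ^ K) ^ card ?W"
    using card_partial_permutation_mats_le[of d] cS by (intro mult_le_mono power_mono) auto
  finally have "card (code ` A) \<le> ((d + 1) ^ d) ^ card I * ((2 * d\<^sup>2 + 1) ^ K) ^ card ?W" .
  moreover have "finite ((\<lambda>\<phi>. restrict \<phi> E) ` A) \<and>
      card ((\<lambda>\<phi>. restrict \<phi> E) ` A) \<le> card (code ` A)"
    by (rule card_image_le_of_factor[OF fin_code]) (rule det)
  ultimately show ?thesis by (meson order_trans)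
qed

lemma ln_card_le:
  assumes "finite A \<and> card A \<le> N" "ln (real N) \<le> x"
  shows "ln_card A \<le> ereal x"
proof (cases "A = {}")
  case False
  then have "0 < card A" using assms(1) by (simp add: card_gt_0_iff)
  then have "ln (real (card A)) \<le> ln (real N)" using assms(1) by simp
  then show ?thesis using assms False by (simp add: ln_card_def)
qed (simp add: ln_card_def)

text \<open>
  The 8 is twice 4: a defect is a set of up to \<open>4 \<delta> d\<close> elements of a set of \<open>2 d\<^sup>2\<close> elements, and
  \<open>log (2 d\<^sup>2)\<close> is about \<open>2 log d\<close>.
\<close>

lemma limsup_rate_le:
  fixes I :: "'i set" and \<delta> :: real
  assumes I: "finite I" and E: "E \<subseteq> insert 0 (ga_of ` short_words I m)"
    and \<delta>: "0 < \<delta>" "\<delta> \<le> 1" and m: "1 \<le> m"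
  shows "sofic_rate limsup (free_group I) E (ga_of ` short_words I m) 2 \<delta>
     \<le> ereal (card I + 8 * \<delta> * card (short_words I m))"
proof -
  let ?A = "SA (free_group I) (ga_of ` short_words I m) 2 \<delta>"
  let ?c = "real (card (short_words I m))"
  let ?u = "\<lambda>d. real (card I) * (real d * ln (real d + 1)) + ?c * (4 * \<delta>) * (real d * ln (2 * (real d)\<^sup>2 + 1))"
  let ?r = "\<lambda>d. ?u d / (real d * ln (real d))"
  have le: "ln_card ((\<lambda>\<phi>. restrict \<phi> E) ` ?A d) / ereal (real d * ln (real d)) \<le> ereal (?r d)"
    if d: "2 \<le> d" for d
  proof -
    let ?K = "nat \<lfloor>4 * \<delta> * real d\<rfloor>"
    let ?N = "((d + 1) ^ d) ^ card I * ((2 * d\<^sup>2 + 1) ^ ?K) ^ card (short_words I m)"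
    have "ln (real ?N) = real (card I) * (real d * ln (real d + 1)) + ?c * (real ?K * ln (2 * (real d)\<^sup>2 + 1))"
    proof -
      have "0 < 1 + 2 * (real d)\<^sup>2" by (simp add: add_pos_nonneg)
      then have "1 + 2 * (real d)\<^sup>2 \<noteq> 0" by simp
      then show ?thesis using d by (simp add: ln_mult ln_realpow add_ac)
    qed
    also have "\<dots> \<le> ?u d"
    proof -
      have "real ?K \<le> 4 * \<delta> * real d" using \<delta> by simp
      then have "?c * (real ?K * ln (2 * (real d)\<^sup>2 + 1)) \<le> ?c * ((4 * \<delta> * real d) * ln (2 * (real d)\<^sup>2 + 1))"
        by (intro mult_left_mono mult_right_mono) auto
      then show ?thesis by (simp add: mult_ac)
    qed
    finally have "ln_card ((\<lambda>\<phi>. restrict \<phi> E) ` ?A d) \<le> ereal (?u d)"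
      using d by (intro ln_card_le[OF card_restrictions_le[OF I E \<delta> _ m]]) auto
    then show ?thesis using d ereal_divide_right_mono[of _ "ereal (?u d)" "ereal (real d * ln (real d))"]
      by simp
  qed
  have "(\<lambda>d::nat. real d * ln (real d + 1) / (real d * ln (real d))) \<longlonglongrightarrow> 1"
    by real_asymp
  moreover have "(\<lambda>d::nat. real d * ln (2 * (real d)\<^sup>2 + 1) / (real d * ln (real d))) \<longlonglongrightarrow> 2"
    by real_asymp
  ultimately have "(\<lambda>d. real (card I) * (real d * ln (real d + 1) / (real d * ln (real d)))
      + ?c * (4 * \<delta>) * (real d * ln (2 * (real d)\<^sup>2 + 1) / (real d * ln (real d))))
      \<longlonglongrightarrow> real (card I) * 1 + ?c * (4 * \<delta>) * 2"
    by (intro tendsto_add tendsto_mult tendsto_const)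
  then have "?r \<longlonglongrightarrow> real (card I) * 1 + ?c * (4 * \<delta>) * 2"
    by (simp only: add_divide_distrib times_divide_eq_right)
  then have "?r \<longlonglongrightarrow> real (card I) + 8 * \<delta> * ?c" by (simp add: mult_ac)
  then have "limsup (\<lambda>d. ereal (?r d)) = ereal (real (card I) + 8 * \<delta> * ?c)"
    by (intro lim_imp_Limsup) auto
  moreover have "sofic_rate limsup (free_group I) E (ga_of ` short_words I m) 2 \<delta>
      \<le> limsup (\<lambda>d. ereal (?r d))"
    unfolding sofic_rate_def
    by (intro Limsup_mono eventually_mono[OF eventually_ge_at_top[of 2]]) (rule le)
  ultimately show ?thesis by simp
qed

text \<open>
  For \<open>F\<close> take all words that are as long as those in \<open>E\<close>. Their number does not depend on \<open>\<delta>\<close>, so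
  the error term in the rate vanishes as \<open>\<delta>\<close> tends to 0.
\<close>

theorem sofic_dimension_free_group_le:
  assumes I: "finite I"
  shows "sofic_dimension (free_group I) \<le> ereal (card I)"
  unfolding sofic_dimension_def sofic_dimension_with_def
proof (rule SUP_least, clarify)
  fix E assume E: "finite E" "E \<subseteq> I_group (free_group I)"
  let ?inf = "INF F\<in>{F. finite F \<and> F \<subseteq> I_group (free_group I)}. INF n\<in>{1..}. INF \<delta>\<in>{0<..}.
      sofic_rate limsup (free_group I) E F n \<delta>"
  have "E - {0} \<subseteq> ga_of ` carrier (free_group I)" using E(2) by (auto simp: I_group_def)
  then obtain C where C: "C \<subseteq> carrier (free_group I)" "finite C" "E - {0} = ga_of ` C"
    using finite_subset_image[of "E - {0}"] E(1) by (metis finite_Diff)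
  obtain m where m: "\<And>w. w \<in> C \<Longrightarrow> length w \<le> m"
    using C(2) by (metis finite_imageI finite_nat_set_iff_bounded_le imageI)
  let ?W = "short_words I (Suc m)"
  have E': "E \<subseteq> insert 0 (ga_of ` ?W)"
  proof
    fix p assume "p \<in> E"
    then have "p = 0 \<or> p \<in> ga_of ` C" using C(3) by blast
    moreover have "C \<subseteq> ?W" using C(1) m by (auto simp: short_words_def le_Suc_eq)
    ultimately show "p \<in> insert 0 (ga_of ` ?W)" by blast
  qed
  show "?inf \<le> ereal (real (card I))"
  proof (rule ereal_le_epsilon2)
    fix \<epsilon> :: real assume \<epsilon>: "0 < \<epsilon>"
    define \<delta> where "\<delta> = min 1 (\<epsilon> / (8 * real (card ?W) + 1))"
    have \<delta>: "0 < \<delta>" "\<delta> \<le> 1" using \<epsilon> by (auto simp: \<delta>_def)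
    have "\<delta> \<le> \<epsilon> / (8 * real (card ?W) + 1)" by (simp add: \<delta>_def)
    then have "\<delta> * (8 * real (card ?W) + 1) \<le> \<epsilon>" by (simp add: pos_le_divide_eq)
    then have le: "8 * \<delta> * real (card ?W) \<le> \<epsilon>" using \<delta> by (simp add: algebra_simps)
    have "?inf \<le> sofic_rate limsup (free_group I) E (ga_of ` ?W) 2 \<delta>"
      using \<delta> finite_short_words[OF I] ga_of_short_words_I_group[of I "Suc m"]
      by (intro INF_lower2[of "ga_of ` ?W"] INF_lower2[of "2 :: nat"] INF_lower2[of \<delta>]) simp_all
    also have "\<dots> \<le> ereal (card I + 8 * \<delta> * card ?W)"
      by (rule limsup_rate_le[OF I E' \<delta>]) simp
    also have "\<dots> \<le> ereal (card I) + ereal \<epsilon>" using le by simp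
    finally show "?inf \<le> ereal (card I) + ereal \<epsilon>" .
  qed
qed

section \<open>Words in permutations have few fixed points\<close>

definition letter_act :: "('i \<Rightarrow> 'a \<Rightarrow> 'a) \<Rightarrow> 'i \<times> bool \<Rightarrow> 'a \<Rightarrow> 'a" where
  "letter_act \<sigma> x = (if snd x then \<sigma> (fst x) else inv_into UNIV (\<sigma> (fst x)))"

definition word_act :: "('i \<Rightarrow> 'a \<Rightarrow> 'a) \<Rightarrow> ('i \<times> bool) list \<Rightarrow> 'a \<Rightarrow> 'a" where
  "word_act \<sigma> w = foldr (letter_act \<sigma>) w"

lemma word_act_simps [simp]:
  "word_act \<sigma> [] a = a"
  "word_act \<sigma> (x # w) a = letter_act \<sigma> x (word_act \<sigma> w a)"
  by (simp_all add: word_act_def)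

lemma letter_act_cancelling:
  assumes "bij (\<sigma> (fst x))" "cancelling x y"
  shows "letter_act \<sigma> x (letter_act \<sigma> y a) = a"
  using assms
  by (cases x; cases y)
    (auto simp: letter_act_def cancelling_def bij_is_inj bij_is_surj surj_f_inv_f)

lemma letter_act_permutes:
  assumes "\<sigma> (fst x) permutes A"
  shows "letter_act \<sigma> x permutes A"
  using assms by (simp add: letter_act_def permutes_inv)

lemma word_act_permutes:
  assumes "\<And>i. i \<in> fst ` set w \<Longrightarrow> \<sigma> i permutes A"
  shows "word_act \<sigma> w permutes A"
  using assms
proof (induction w)
  case Nil
  then show ?case using permutes_id by (simp add: word_act_def id_def)
next
  case (Cons x w)
  then have "letter_act \<sigma> x \<circ> word_act \<sigma> w permutes A"
    by (intro permutes_compose letter_act_permutes) auto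
  then show ?case by (simp add: word_act_def comp_def)
qed

lemma word_act_reduced_Cons:
  assumes "bij (\<sigma> (fst x))"
  shows "word_act \<sigma> (reduced_Cons x w) a = letter_act \<sigma> x (word_act \<sigma> w a)"
  using assms by (cases w) (auto simp: letter_act_cancelling)

lemma word_act_mult:
  assumes "\<And>i. i \<in> fst ` set u \<Longrightarrow> bij (\<sigma> i)"
  shows "word_act \<sigma> (foldr reduced_Cons u v) a = word_act \<sigma> u (word_act \<sigma> v a)"
  using assms by (induction u) (auto simp: word_act_reduced_Cons)

text \<open>
  The points visited while \<open>w\<close> acts on \<open>a\<close> letter by letter, in reverse order: the last letter acts
  first, and the list begins with the end point and ends with \<open>a\<close>.
\<close>

fun trail :: "('i \<Rightarrow> 'a \<Rightarrow> 'a) \<Rightarrow> ('i \<times> bool) list \<Rightarrow> 'a \<Rightarrow> 'a list" where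
  "trail \<sigma> [] a = [a]"
| "trail \<sigma> (x # w) a = word_act \<sigma> (x # w) a # trail \<sigma> w a"

lemma length_trail [simp]: "length (trail \<sigma> w a) = Suc (length w)"
  by (induction w) auto

lemma word_act_in_trail: "word_act \<sigma> u a \<in> set (trail \<sigma> (v @ u) a)"
proof (induction v)
  case Nil
  then show ?case by (cases u) auto
qed auto

lemma hd_trail: "hd (trail \<sigma> w a) = word_act \<sigma> w a"
  by (cases w) auto

lemma distinct_trail_word_act:
  assumes "distinct (trail \<sigma> (v @ u) a)" "word_act \<sigma> u a = word_act \<sigma> (v @ u) a"
  shows "v = []"
proof (cases v)
  case (Cons x v')
  then show ?thesis using assms word_act_in_trail[of \<sigma> u a v'] by auto
qed simp

text \<open>
  The action of the letter \<open>x\<close>, whether a generator or an inverse, is followed by the transposition of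
  \<open>p\<close> and \<open>y\<close>: the step of \<open>x\<close> that led to \<open>p\<close> is redirected to \<open>y\<close>.
\<close>

definition switch :: "'i \<times> bool \<Rightarrow> 'a \<Rightarrow> 'a \<Rightarrow> ('i \<Rightarrow> 'a \<Rightarrow> 'a) \<Rightarrow> 'i \<Rightarrow> 'a \<Rightarrow> 'a" where
  "switch x p y \<sigma> =
     \<sigma>(fst x := if snd x then Transposition.transpose p y \<circ> \<sigma> (fst x)
                else \<sigma> (fst x) \<circ> Transposition.transpose p y)"

lemma switch_switch [simp]: "switch x p y (switch x p y \<sigma>) = \<sigma>"
  by (auto simp: switch_def fun_eq_iff)

lemma letter_act_switch:
  assumes "bij (\<sigma> (fst x))"
  shows "letter_act (switch x p y \<sigma>) x = Transposition.transpose p y \<circ> letter_act \<sigma> x"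
  using assms by (auto simp: letter_act_def switch_def o_inv_distrib)

lemma letter_act_switch_cancelling:
  assumes "bij (\<sigma> (fst x))" "cancelling x z"
  shows "letter_act (switch x p y \<sigma>) z = letter_act \<sigma> z \<circ> Transposition.transpose p y"
  using assms by (auto simp: letter_act_def switch_def o_inv_distrib cancelling_def)

lemma letter_act_switch_other:
  assumes "fst z \<noteq> fst x"
  shows "letter_act (switch x p y \<sigma>) z = letter_act \<sigma> z"
  using assms by (auto simp: letter_act_def switch_def)

text \<open>
  When the letter \<open>x\<close> takes the end point of the trail of \<open>v\<close> to \<open>p\<close>, the redirection of that step to a new
  point \<open>y\<close> leaves the trail of \<open>v\<close> intact. Its steps avoid \<open>y\<close>. A step by \<open>x\<close> into \<open>p\<close> would start in the end
  point, which is visited only once. A step by the inverse of \<open>x\<close> out of \<open>p\<close> would lead into the end point,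
  so it would be the last one, and \<open>x # v\<close> would not be reduced.
\<close>

lemma trail_switch_suffix:
  fixes \<sigma> :: "'i \<Rightarrow> 'a \<Rightarrow> 'a"
  assumes bij: "bij (\<sigma> (fst x))" and red: "reduced (x # v)"
    and dist: "distinct (trail \<sigma> v a)"
    and p: "p = letter_act \<sigma> x (word_act \<sigma> v a)" 
    and y: "y \<notin> set (trail \<sigma> v a)"
  shows "v = pre @ u \<Longrightarrow> trail (switch x p y \<sigma>) u a = trail \<sigma> u a"
proof (induction u arbitrary: pre)
  case (Cons z u)
  let ?s = "switch x p y \<sigma>"
  let ?q = "word_act \<sigma> u a"
  have IH: "trail ?s u a = trail \<sigma> u a" using Cons.IH[of "pre @ [z]"] Cons.prems by simp
  then have q: "word_act ?s u a = ?q" by (metis hd_trail)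
  have v': "v = (pre @ [z]) @ u" using Cons.prems by simp
  have q_in: "?q \<in> set (trail \<sigma> v a)" unfolding v' by (rule word_act_in_trail)
  have q_ne: "?q \<noteq> word_act \<sigma> v a"
    using distinct_trail_word_act[of \<sigma> "pre @ [z]" u a] dist v' by auto
  have q'_in: "letter_act \<sigma> z ?q \<in> set (trail \<sigma> v a)"
    using word_act_in_trail[of \<sigma> "z # u" a pre] Cons.prems by simp
  have "letter_act ?s z ?q = letter_act \<sigma> z ?q"
  proof -
    consider "fst z \<noteq> fst x" | "z = x" | "cancelling x z"
      unfolding cancelling_def prod_eq_iff by metis
    then show ?thesis
    proof cases
      case 1
      then show ?thesis by (simp add: letter_act_switch_other)
    next
      case 2
      have "bij (letter_act \<sigma> x)" using bij by (simp add: letter_act_def bij_imp_bij_inv)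
      then have "letter_act \<sigma> x ?q \<noteq> p"
        using q_ne p by (metis bij_pointE)
      moreover have "letter_act \<sigma> x ?q \<noteq> y" using q'_in y 2 by auto
      ultimately show ?thesis using 2 bij by (simp add: letter_act_switch)
    next
      case 3
      have "?q \<noteq> p"
      proof
        assume "?q = p"
        then have "word_act \<sigma> (z # u) a = word_act \<sigma> v a"
          using p 3 bij letter_act_cancelling[of \<sigma> z x] by (auto simp: cancelling_def)
        then have "pre = []" using distinct_trail_word_act[of \<sigma> pre "z # u" a] dist Cons.prems by metis
        then show False using red 3 Cons.prems by (simp add: reduced_def)
      qed
      moreover have "?q \<noteq> y" using q_in y by auto
      ultimately show ?thesis using 3 bij by (simp add: letter_act_switch_cancelling)
    qed
  qed
  then show ?case using IH q by simp
qed simp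

lemmas trail_switch = trail_switch_suffix[where pre = "[]", simplified]

definition perm_tuples :: "'i set \<Rightarrow> nat \<Rightarrow> ('i \<Rightarrow> nat \<Rightarrow> nat) set" where
  "perm_tuples K d = PiE K (\<lambda>_. {f. f permutes {..<d}})"

lemma finite_perm_tuples: "finite K \<Longrightarrow> finite (perm_tuples K d)"
  by (simp add: perm_tuples_def finite_PiE finite_permutations)

lemma card_perm_tuples: "finite K \<Longrightarrow> card (perm_tuples K d) = fact d ^ card K"
  by (simp add: perm_tuples_def card_PiE card_permutations)

lemma perm_tuples_permutes: "\<sigma> \<in> perm_tuples K d \<Longrightarrow> i \<in> K \<Longrightarrow> \<sigma> i permutes {..<d}"
  by (auto simp: perm_tuples_def)

lemma switch_perm_tuples:
  assumes "\<sigma> \<in> perm_tuples K d" "fst x \<in> K" "p < d" "y < d"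
  shows "switch x p y \<sigma> \<in> perm_tuples K d"
proof -
  have "Transposition.transpose p y permutes {..<d}"
    using assms by (intro permutes_swap_id) auto
  then show ?thesis
    using assms unfolding perm_tuples_def switch_def
    by (auto intro: permutes_compose simp: PiE_iff extensional_def)
qed

lemma trail_less:
  assumes "\<sigma> \<in> perm_tuples K d" "fst ` set w \<subseteq> K" "a < d"
  shows "set (trail \<sigma> w a) \<subseteq> {..<d}"
  using assms(2)
proof (induction w)
  case (Cons x w)
  have "word_act \<sigma> (x # w) permutes {..<d}"
    using Cons.prems by (intro word_act_permutes perm_tuples_permutes[OF assms(1)]) auto
  then have "word_act \<sigma> (x # w) a < d" using permutes_in_image[of _ "{..<d}" a] assms(3) by blast
  then show ?case using Cons by simp
qed (use assms in simp)

text \<open>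
  A tuple for which the letter \<open>x\<close> closes the trail at its \<open>s\<close>-th point can be switched so that the trail
  continues to any of the \<open>d - length v - 1\<close> unvisited points \<open>y\<close>. The switched tuple has the same trail
  for \<open>v\<close>, shows \<open>y\<close> as its next point, and switching back restores the tuple. So distinct pairs of a
  tuple and a point \<open>y\<close> give distinct switched tuples.
\<close>

lemma card_collision_at:
  fixes x :: "'i \<times> bool"
  assumes K: "finite K" "fst x \<in> K" "fst ` set v \<subseteq> K"
    and red: "reduced (x # v)" and a: "a < d" and s: "s \<le> length v"
  defines "B \<equiv> {\<sigma> \<in> perm_tuples K d. distinct (trail \<sigma> v a) \<and>
                  letter_act \<sigma> x (word_act \<sigma> v a) = trail \<sigma> v a ! s}"
  shows "card B * (d - Suc (length v)) \<le> card (perm_tuples K d)"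
proof -
  let ?P = "SIGMA \<sigma>:B. {..<d} - set (trail \<sigma> v a)"
  let ?f = "\<lambda>(\<sigma>, y). switch x (trail \<sigma> v a ! s) y \<sigma>"
  have finB: "finite B" unfolding B_def using finite_perm_tuples[OF K(1)] by simp
  have bij: "bij (\<sigma> (fst x))" if "\<sigma> \<in> B" for \<sigma>
    using that permutes_bij[OF perm_tuples_permutes[OF _ K(2), of \<sigma> d]] by (simp add: B_def)
  have tr: "trail (switch x (trail \<sigma> v a ! s) y \<sigma>) v a = trail \<sigma> v a"
    if "\<sigma> \<in> B" "y \<in> {..<d} - set (trail \<sigma> v a)" for \<sigma> y
    using that by (intro trail_switch[OF bij red]) (simp_all add: B_def)
  have recover: "letter_act \<sigma>' x (word_act \<sigma>' v a) = y"
    if h: "\<sigma> \<in> B" "y \<in> {..<d} - set (trail \<sigma> v a)"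
      and \<sigma>': "\<sigma>' = switch x (trail \<sigma> v a ! s) y \<sigma>" for \<sigma> \<sigma>' y
  proof -
    have "trail \<sigma>' v a = trail \<sigma> v a" unfolding \<sigma>' by (rule tr[OF h])
    then have "word_act \<sigma>' v a = word_act \<sigma> v a" by (metis hd_trail)
    moreover have "letter_act \<sigma> x (word_act \<sigma> v a) = trail \<sigma> v a ! s"
      using h(1) by (simp add: B_def)
    moreover have "letter_act \<sigma>' x = Transposition.transpose (trail \<sigma> v a ! s) y \<circ> letter_act \<sigma> x"
      unfolding \<sigma>' by (rule letter_act_switch, rule bij, rule h(1))
    ultimately show ?thesis by simp
  qed
  have card: "card ({..<d} - set (trail \<sigma> v a)) = d - Suc (length v)" if "\<sigma> \<in> B" for \<sigma>
  proof -
    have "set (trail \<sigma> v a) \<subseteq> {..<d}" using that K(3) a unfolding B_def by (intro trail_less) auto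
    then have "card ({..<d} - set (trail \<sigma> v a)) = d - card (set (trail \<sigma> v a))"
      by (subst card_Diff_subset) auto
    moreover have "distinct (trail \<sigma> v a)" using that by (simp add: B_def)
    ultimately show ?thesis using distinct_card[of "trail \<sigma> v a"] by simp
  qed
  have inj: "\<sigma> = \<sigma>' \<and> y = y'"
    if h: "\<sigma> \<in> B" "y \<in> {..<d}" "y \<notin> set (trail \<sigma> v a)"
      "\<sigma>' \<in> B" "y' \<in> {..<d}" "y' \<notin> set (trail \<sigma>' v a)"
      and eq: "switch x (trail \<sigma> v a ! s) y \<sigma> = switch x (trail \<sigma>' v a ! s) y' \<sigma>'"
    for \<sigma> y \<sigma>' y'
  proof -
    have y_in: "y \<in> {..<d} - set (trail \<sigma> v a)" "y' \<in> {..<d} - set (trail \<sigma>' v a)"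
      using h by auto
    have t: "trail \<sigma> v a = trail \<sigma>' v a"
      using tr[OF h(1) y_in(1)] tr[OF h(4) y_in(2)] unfolding eq by (rule trans[OF sym])
    moreover have y: "y = y'"
      using recover[OF h(1) y_in(1) refl] recover[OF h(4) y_in(2) eq]
      by (rule trans[OF sym])
    ultimately have "\<sigma> = \<sigma>'" using eq by (metis switch_switch)
    with y show ?thesis by simp
  qed
  have "inj_on ?f ?P"
    by (rule inj_onI) (use inj in auto)
  moreover have "switch x (trail \<sigma> v a ! s) y \<sigma> \<in> perm_tuples K d"
    if h: "\<sigma> \<in> B" "y \<in> {..<d}" for \<sigma> y
  proof -
    have "trail \<sigma> v a ! s \<in> {..<d}"
      by (rule subsetD[OF trail_less nth_mem]) (use h K(3) a s in \<open>auto simp: B_def\<close>)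
    then show ?thesis
      using h K(2) by (intro switch_perm_tuples) (auto simp: B_def)
  qed
  then have "?f ` ?P \<subseteq> perm_tuples K d" by auto
  ultimately have "card ?P \<le> card (perm_tuples K d)"
    using finite_perm_tuples[OF K(1)] by (rule card_inj_on_le)
  moreover have "card ?P = card B * (d - Suc (length v))"
    using finB card by (subst card_SigmaI) auto
  ultimately show ?thesis by simp
qed

text \<open>
  One of at most \<open>m\<close> letters is the first to close the trail, at one of at most \<open>m\<close> visited points.
\<close>

lemma card_not_distinct_trail:
  assumes K: "finite K" and a: "a < d"
  shows "reduced w \<Longrightarrow> fst ` set w \<subseteq> K \<Longrightarrow> length w \<le> m \<Longrightarrow>
    card {\<sigma> \<in> perm_tuples K d. \<not> distinct (trail \<sigma> w a)} * (d - m)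
      \<le> length w * m * card (perm_tuples K d)"
proof (induction w)
  case (Cons x v)
  let ?T = "perm_tuples K d"
  let ?B = "\<lambda>s. {\<sigma> \<in> ?T. distinct (trail \<sigma> v a) \<and>
                  letter_act \<sigma> x (word_act \<sigma> v a) = trail \<sigma> v a ! s}"
  let ?N = "{\<sigma> \<in> ?T. \<not> distinct (trail \<sigma> v a)}"
  have red: "reduced v" using Cons.prems(1) by (auto simp: reduced_def successively_Cons)
  have finT: "finite ?T" using K by (rule finite_perm_tuples)
  have "{\<sigma> \<in> ?T. \<not> distinct (trail \<sigma> (x # v) a)} \<subseteq> ?N \<union> (\<Union>s\<in>{..length v}. ?B s)"
    by (auto simp: in_set_conv_nth less_Suc_eq_le)
  then have "card {\<sigma> \<in> ?T. \<not> distinct (trail \<sigma> (x # v) a)}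
      \<le> card (?N \<union> (\<Union>s\<in>{..length v}. ?B s))"
    using finT by (intro card_mono) auto
  also have "\<dots> \<le> card ?N + card (\<Union>s\<in>{..length v}. ?B s)" by (rule card_Un_le)
  also have "card (\<Union>s\<in>{..length v}. ?B s) \<le> (\<Sum>s\<in>{..length v}. card (?B s))"
    by (rule card_UN_le) simp
  finally have "card {\<sigma> \<in> ?T. \<not> distinct (trail \<sigma> (x # v) a)} * (d - m)
      \<le> card ?N * (d - m) + (\<Sum>s\<in>{..length v}. card (?B s) * (d - m))"
    by (simp add: sum_distrib_right[symmetric] add_mult_distrib[symmetric])
  also have "card ?N * (d - m) \<le> length v * m * card ?T"
    using Cons red by auto
  also have "(\<Sum>s\<in>{..length v}. card (?B s) * (d - m)) \<le> (\<Sum>s\<in>{..length v}. card ?T)"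
  proof (rule sum_mono)
    fix s assume "s \<in> {..length v}"
    then have "card (?B s) * (d - Suc (length v)) \<le> card ?T"
      using Cons.prems a K by (intro card_collision_at) auto
    moreover have "d - m \<le> d - Suc (length v)" using Cons.prems(3) by auto
    ultimately show "card (?B s) * (d - m) \<le> card ?T"
      by (meson le_trans mult_le_mono2)
  qed
  also have "(\<Sum>s\<in>{..length v}. card ?T) \<le> m * card ?T"
    using mult_le_mono1[OF Cons.prems(3), of "card ?T"] by simp
  finally show ?case by (simp add: algebra_simps)
qed simp

lemma card_fixing_word:
  assumes "finite K" "a < d" "reduced w" "fst ` set w \<subseteq> K" "w \<noteq> []"
  shows "card {\<sigma> \<in> perm_tuples K d. word_act \<sigma> w a = a} * (d - length w)
     \<le> (length w)\<^sup>2 * card (perm_tuples K d)"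
proof -
  have "w = []" if "distinct (trail \<sigma> w a)" "word_act \<sigma> w a = a" for \<sigma>
    using distinct_trail_word_act[of \<sigma> w "[]" a] that by simp
  then have "{\<sigma> \<in> perm_tuples K d. word_act \<sigma> w a = a} \<subseteq>
        {\<sigma> \<in> perm_tuples K d. \<not> distinct (trail \<sigma> w a)}"
    using assms(5) by blast
  then have "card {\<sigma> \<in> perm_tuples K d. word_act \<sigma> w a = a} \<le>
        card {\<sigma> \<in> perm_tuples K d. \<not> distinct (trail \<sigma> w a)}"
    using finite_perm_tuples[OF assms(1)] by (intro card_mono) auto
  then have "card {\<sigma> \<in> perm_tuples K d. word_act \<sigma> w a = a} * (d - length w) \<le>
      card {\<sigma> \<in> perm_tuples K d. \<not> distinct (trail \<sigma> w a)} * (d - length w)"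
    by simp
  also have "\<dots> \<le> (length w)\<^sup>2 * card (perm_tuples K d)"
    using card_not_distinct_trail[OF assms(1,2,3,4) order_refl] by (simp add: power2_eq_square)
  finally show ?thesis .
qed

text \<open>
  Markov's inequality: the pairs of a tuple and a fixed point of \<open>w\<close> are counted in two ways.
\<close>

lemma card_many_fixed_points:
  fixes \<delta> :: real and K :: "'i set"
  assumes K: "finite K" and w: "reduced w" "fst ` set w \<subseteq> K" "w \<noteq> []" and d: "0 < d" "length w \<le> d"
  defines "B \<equiv> {\<sigma> \<in> perm_tuples K d. \<delta> * real d \<le> real (card {a \<in> {..<d}. word_act \<sigma> w a = a})}"
  shows "\<delta> * (real d - real (length w)) * real (card B) \<le> (real (length w))\<^sup>2 * real (card (perm_tuples K d))"
proof -
  let ?T = "perm_tuples K d" and ?l = "real (length w)"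
  have finT: "finite ?T" using K by (rule finite_perm_tuples)
  have "\<delta> * real d * real (card B) = (\<Sum>\<sigma>\<in>B. \<delta> * real d)" by simp
  also have "\<dots> \<le> (\<Sum>\<sigma>\<in>B. real (card {a \<in> {..<d}. word_act \<sigma> w a = a}))"
    by (rule sum_mono) (simp add: B_def)
  also have "\<dots> \<le> (\<Sum>\<sigma>\<in>?T. real (card {a \<in> {..<d}. word_act \<sigma> w a = a}))"
    using finT by (intro sum_mono2) (auto simp: B_def)
  also have "\<dots> = (\<Sum>\<sigma>\<in>?T. \<Sum>a<d. if word_act \<sigma> w a = a then 1 else 0)"
    by (simp add: sum.If_cases Int_def)
  also have "\<dots> = (\<Sum>a<d. \<Sum>\<sigma>\<in>?T. if word_act \<sigma> w a = a then 1 else 0)"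
    by (rule sum.swap)
  also have "\<dots> = (\<Sum>a<d. real (card {\<sigma> \<in> ?T. word_act \<sigma> w a = a}))"
    using finT by (simp add: sum.If_cases Int_def)
  finally have "\<delta> * real d * real (card B) * (real d - ?l)
      \<le> (\<Sum>a<d. real (card {\<sigma> \<in> ?T. word_act \<sigma> w a = a})) * (real d - ?l)"
    using d by (intro mult_right_mono) auto
  also have "\<dots> = (\<Sum>a<d. real (card {\<sigma> \<in> ?T. word_act \<sigma> w a = a} * (d - length w)))"
    using d by (simp add: sum_distrib_right of_nat_diff)
  also have "\<dots> \<le> (\<Sum>a<d. real ((length w)\<^sup>2 * card ?T))"
    using card_fixing_word[OF K _ w] by (intro sum_mono of_nat_mono) auto
  finally have "real d * (\<delta> * (real d - ?l) * real (card B)) \<le> real d * (?l\<^sup>2 * real (card ?T))"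
    by (simp add: mult_ac)
  then show ?thesis using d by simp
qed

text \<open>
  Random permutations are asymptotically free: the proportion of tuples that violate one of the
  finitely many conditions is of order \<open>1 / d\<close>.
\<close>

lemma most_tuples_few_fixed_points:
  fixes \<delta> :: real and K :: "'i set" and W :: "('i \<times> bool) list set"
  assumes K: "finite K" and W: "finite W" "\<And>w. w \<in> W \<Longrightarrow> reduced w \<and> fst ` set w \<subseteq> K \<and> w \<noteq> []"
    and \<delta>: "0 < \<delta>"
  shows "eventually (\<lambda>d. real (card (perm_tuples K d)) / 2 \<le>
    real (card {\<sigma> \<in> perm_tuples K d. \<forall>w\<in>W. real (card {a \<in> {..<d}. word_act \<sigma> w a = a}) < \<delta> * real d}))
    sequentially"
proof -
  obtain L where L: "\<And>w. w \<in> W \<Longrightarrow> length w \<le> L"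
    using W(1) by (metis finite_imageI finite_nat_set_iff_bounded_le imageI)
  let ?L = "real L"
  \<comment> \<open>From \<open>D\<close> on, at most the fraction \<open>1 / (2 card W)\<close> of the tuples violates the condition at a given word.\<close>
  obtain D where D: "?L + 2 * real (card W) * ?L\<^sup>2 / \<delta> + 1 \<le> real D" by (metis real_arch_simple)
  show ?thesis
  proof (rule eventually_mono[OF eventually_ge_at_top[of D]])
    fix d assume "D \<le> d"
    then have d: "?L + 2 * real (card W) * ?L\<^sup>2 / \<delta> + 1 \<le> real d" using D by linarith
    have nn: "0 \<le> 2 * real (card W) * ?L\<^sup>2 / \<delta>" using \<delta> by simp
    have Ld: "?L + 1 \<le> real d" using d nn by linarith
    then have d0: "0 < d" "L \<le> d" by simp_all
    have "2 * real (card W) * ?L\<^sup>2 / \<delta> \<le> real d - ?L" using d by linarith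
    then have big: "2 * real (card W) * ?L\<^sup>2 \<le> \<delta> * (real d - ?L)"
      using \<delta> by (simp add: pos_divide_le_eq mult.commute)
    let ?T = "perm_tuples K d"
    let ?B = "\<lambda>w. {\<sigma> \<in> ?T. \<delta> * real d \<le> real (card {a \<in> {..<d}. word_act \<sigma> w a = a})}"
    let ?good = "{\<sigma> \<in> ?T. \<forall>w\<in>W. real (card {a \<in> {..<d}. word_act \<sigma> w a = a}) < \<delta> * real d}"
    have finT: "finite ?T" using K by (rule finite_perm_tuples)
    have each: "2 * real (card W) * real (card (?B w)) \<le> real (card ?T)" if w: "w \<in> W" for w
    proof -
      have l: "real (length w) \<le> ?L" "0 < length w" using L[OF w] W(2)[OF w] by auto
      then have L0: "0 < ?L" by linarith
      have "?L\<^sup>2 * (2 * real (card W) * real (card (?B w))) = (2 * real (card W) * ?L\<^sup>2) * real (card (?B w))"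
        by simp
      also have "\<dots> \<le> \<delta> * (real d - ?L) * real (card (?B w))"
        using big by (intro mult_right_mono) auto
      also have "\<dots> \<le> \<delta> * (real d - real (length w)) * real (card (?B w))"
        using \<delta> l by (intro mult_right_mono mult_left_mono) auto
      also have "\<dots> \<le> (real (length w))\<^sup>2 * real (card ?T)"
        using card_many_fixed_points[OF K, of w d \<delta>] W(2)[OF w] d0 L[OF w] by simp
      also have "\<dots> \<le> ?L\<^sup>2 * real (card ?T)"
        using l by (intro mult_right_mono power_mono) auto
      finally show ?thesis using L0 by simp
    qed
    have "2 * (\<Sum>w\<in>W. real (card (?B w))) \<le> real (card ?T)"
    proof (cases "W = {}")
      case False
      have "real (card W) * (2 * (\<Sum>w\<in>W. real (card (?B w)))) = (\<Sum>w\<in>W. 2 * real (card W) * real (card (?B w)))"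
        by (simp add: sum_distrib_left mult_ac)
      also have "\<dots> \<le> (\<Sum>w\<in>W. real (card ?T))" by (rule sum_mono) (rule each)
      also have "\<dots> = real (card W) * real (card ?T)" by simp
      finally show ?thesis using False W(1) by (simp add: card_gt_0_iff)
    qed simp
    moreover have "card ?T \<le> card ?good + (\<Sum>w\<in>W. card (?B w))"
    proof -
      have "?T \<subseteq> ?good \<union> (\<Union>w\<in>W. ?B w)" by (auto simp: not_less)
      then have "card ?T \<le> card (?good \<union> (\<Union>w\<in>W. ?B w))"
        using finT W(1) by (intro card_mono) auto
      also have "\<dots> \<le> card ?good + card (\<Union>w\<in>W. ?B w)" by (rule card_Un_le)
      also have "card (\<Union>w\<in>W. ?B w) \<le> (\<Sum>w\<in>W. card (?B w))" by (rule card_UN_le[OF W(1)])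
      finally show ?thesis by simp
    qed
    then have "real (card ?T) \<le> real (card ?good) + (\<Sum>w\<in>W. real (card (?B w)))"
      unfolding of_nat_sum[symmetric] of_nat_add[symmetric] by (rule of_nat_mono)
    ultimately show "real (card ?T) / 2 \<le> real (card ?good)" by simp
  qed
qed

section \<open>Sofic approximations from permutations\<close>

definition perm_mat :: "nat \<Rightarrow> (nat \<Rightarrow> nat) \<Rightarrow> complex mat" where
  "perm_mat d f = mat d d (\<lambda>(i, j). if f j = i then 1 else 0)"

lemma perm_mat_carrier [simp]: "perm_mat d f \<in> carrier_mat d d"
  by (simp add: perm_mat_def)

lemma perm_mat_index: "i < d \<Longrightarrow> j < d \<Longrightarrow> perm_mat d f $$ (i, j) = (if f j = i then 1 else 0)"
  by (simp add: perm_mat_def)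

lemma perm_mat_mult:
  assumes "g permutes {..<d}"
  shows "perm_mat d f * perm_mat d g = perm_mat d (f \<circ> g)"
proof (rule eq_matI)
  fix i j assume "i < dim_row (perm_mat d (f \<circ> g))" "j < dim_col (perm_mat d (f \<circ> g))"
  then have ij: "i < d" "j < d" by (simp_all add: perm_mat_def)
  then have gj: "g j < d" using permutes_in_image[OF assms, of j] by simp
  have "(perm_mat d f * perm_mat d g) $$ (i, j) =
      (\<Sum>k<d. if k = g j then (if f k = i then 1 else 0) else 0)"
    unfolding mult_mat_index[OF perm_mat_carrier perm_mat_carrier ij]
    using ij by (intro sum.cong) (auto simp: perm_mat_index)
  also have "\<dots> = (if f (g j) = i then 1 else 0)" using gj by (subst sum.delta) auto
  finally show "(perm_mat d f * perm_mat d g) $$ (i, j) = perm_mat d (f \<circ> g) $$ (i, j)"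
    using ij by (simp add: perm_mat_index)
qed (simp_all add: perm_mat_def)

lemma perm_mat_id: "perm_mat d id = 1\<^sub>m d"
  by (rule eq_matI) (auto simp: perm_mat_def)

lemma perm_mat_adjoint:
  assumes "f permutes {..<d}"
  shows "mat_adjoint (perm_mat d f) = perm_mat d (inv_into UNIV f)"
proof (rule eq_matI)
  fix i j assume "i < dim_row (perm_mat d (inv_into UNIV f))" "j < dim_col (perm_mat d (inv_into UNIV f))"
  then have ij: "i < d" "j < d" by (simp_all add: perm_mat_def)
  then show "mat_adjoint (perm_mat d f) $$ (i, j) = perm_mat d (inv_into UNIV f) $$ (i, j)"
    using permutes_inv_eq[OF assms, of j i]
    by (auto simp: mat_adjoint_index[OF perm_mat_carrier] perm_mat_index)
qed (use mat_adjoint_carrier[OF perm_mat_carrier[of d f]] in \<open>auto simp: perm_mat_def\<close>)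

lemma perm_mat_partial_permutation:
  assumes "f permutes {..<d}"
  shows "perm_mat d f \<in> partial_permutation_mats d"
proof -
  have "perm_mat d f * mat_adjoint (perm_mat d f) * perm_mat d f = perm_mat d f"
    using assms
    by (simp add: perm_mat_adjoint perm_mat_mult permutes_inv permutes_inv_o(1) perm_mat_id
        left_mult_one_mat[OF perm_mat_carrier])
  then show ?thesis
    by (simp add: partial_permutation_mats_def partial_isometry_def perm_mat_index)
qed

lemma perm_mat_inject:
  assumes "f permutes {..<d}" "g permutes {..<d}" "perm_mat d f = perm_mat d g"
  shows "f = g"
proof
  fix j
  show "f j = g j"
  proof (cases "j < d")
    case True
    then have "f j < d" using permutes_in_image[OF assms(1), of j] by simp
    then have "perm_mat d g $$ (f j, j) = 1" using True assms(3)[symmetric] by (simp add: perm_mat_index)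
    then show ?thesis using True \<open>f j < d\<close> by (simp add: perm_mat_index split: if_splits)
  next
    case False
    then show ?thesis 
      using permutes_not_in[OF assms(1), of j] permutes_not_in[OF assms(2), of j] by simp
  qed
qed

lemma normalized_trace_perm_mat:
  "normalized_trace d (perm_mat d f) = of_nat (card {a \<in> {..<d}. f a = a}) / of_nat d"
  unfolding normalized_trace_def
  by (simp add: perm_mat_index sum.If_cases Int_def)

lemma zero_partial_permutation: "0\<^sub>m d d \<in> partial_permutation_mats d"
proof -
  have "mat_adjoint (0\<^sub>m d d :: complex mat) \<in> carrier_mat d d"
    by (rule mat_adjoint_carrier) simp
  then show ?thesis by (simp add: partial_permutation_mats_def partial_isometry_def)
qed

text \<open>
  The linear extension to the group algebra of the permutation representation that is given by \<open>\<sigma>\<close>.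
\<close>

definition perm_rep :: "nat \<Rightarrow> ('i \<Rightarrow> nat \<Rightarrow> nat) \<Rightarrow> (('i \<times> bool) list \<Rightarrow>\<^sub>0 complex) \<Rightarrow> complex mat" where
  "perm_rep d \<sigma> p = mat d d (\<lambda>(i, j).
     \<Sum>w\<in>Poly_Mapping.keys p. Poly_Mapping.lookup p w * (if word_act \<sigma> w j = i then 1 else 0))"

lemma sum_keys_superset:
  assumes "finite A" "Poly_Mapping.keys p \<subseteq> A"
  shows "(\<Sum>w\<in>Poly_Mapping.keys p. Poly_Mapping.lookup p w * c w) =
         (\<Sum>w\<in>A. Poly_Mapping.lookup p w * (c w :: complex))"
  using assms by (intro sum.mono_neutral_left) (auto simp: in_keys_iff)

lemma perm_rep_linear: "perm_rep d \<sigma> \<in> linear_to_mats G d"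
proof -
  have "perm_rep d \<sigma> (p + q) = perm_rep d \<sigma> p + perm_rep d \<sigma> q" for p q
  proof (rule eq_matI)
    fix i j assume "i < dim_row (perm_rep d \<sigma> p + perm_rep d \<sigma> q)"
      "j < dim_col (perm_rep d \<sigma> p + perm_rep d \<sigma> q)"
    then have ij: "i < d" "j < d" by (simp_all add: perm_rep_def)
    let ?K = "Poly_Mapping.keys p \<union> Poly_Mapping.keys q"
    have K: "finite ?K" "Poly_Mapping.keys (p + q) \<subseteq> ?K"
      using Poly_Mapping.keys_add[of p q] by simp_all
    show "perm_rep d \<sigma> (p + q) $$ (i, j) = (perm_rep d \<sigma> p + perm_rep d \<sigma> q) $$ (i, j)"
      using ij sum_keys_superset[OF K] sum_keys_superset[of ?K p] sum_keys_superset[of ?K q]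
      by (simp add: perm_rep_def lookup_add distrib_right sum.distrib)
  qed (simp_all add: perm_rep_def)
  moreover have "perm_rep d \<sigma> (ga_smult c p) = c \<cdot>\<^sub>m perm_rep d \<sigma> p" for c p
  proof (rule eq_matI)
    fix i j assume "i < dim_row (c \<cdot>\<^sub>m perm_rep d \<sigma> p)" "j < dim_col (c \<cdot>\<^sub>m perm_rep d \<sigma> p)"
    then have ij: "i < d" "j < d" by (simp_all add: perm_rep_def)
    have lk: "Poly_Mapping.lookup (ga_smult c p) w = c * Poly_Mapping.lookup p w" for w
      by (simp add: ga_smult_def Poly_Mapping.map.rep_eq when_def)
    have "Poly_Mapping.keys (ga_smult c p) \<subseteq> Poly_Mapping.keys p"
      by (auto simp: in_keys_iff lk)
    then show "perm_rep d \<sigma> (ga_smult c p) $$ (i, j) = (c \<cdot>\<^sub>m perm_rep d \<sigma> p) $$ (i, j)"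
      using ij sum_keys_superset[of "Poly_Mapping.keys p" "ga_smult c p"]
      by (simp add: perm_rep_def lk sum_distrib_left mult.assoc)
  qed (simp_all add: perm_rep_def)
  moreover have "perm_rep d \<sigma> p \<in> carrier_mat d d" for p by (simp add: perm_rep_def)
  ultimately show ?thesis by (simp add: linear_to_mats_def)
qed

lemma perm_rep_ga_of: "perm_rep d \<sigma> (ga_of w) = perm_mat d (word_act \<sigma> w)"
  by (rule eq_matI) (auto simp: perm_rep_def perm_mat_def ga_of_def)

lemma perm_rep_zero: "perm_rep d \<sigma> 0 = 0\<^sub>m d d"
  by (rule eq_matI) (auto simp: perm_rep_def)

lemma perm_rep_mult:
  assumes \<sigma>: "\<And>i. \<sigma> i permutes {..<d}"
    and "p \<in> I_group (free_group I)" "q \<in> I_group (free_group I)"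
  shows "perm_rep d \<sigma> (ga_mult (free_group I) p q) = perm_rep d \<sigma> p * perm_rep d \<sigma> q"
proof -
  have hom: "word_act \<sigma> (foldr reduced_Cons u v) = word_act \<sigma> u \<circ> word_act \<sigma> v" for u v
    by (rule ext) (simp add: word_act_mult permutes_bij[OF \<sigma>])
  have c: "perm_rep d \<sigma> p \<in> carrier_mat d d" for p by (simp add: perm_rep_def)
  have "p = 0 \<or> (\<exists>u. p = ga_of u)" "q = 0 \<or> (\<exists>v. q = ga_of v)"
    using assms(2,3) by (auto simp: I_group_def)
  then show ?thesis
    using c[of p] c[of q]
    by (auto simp: perm_rep_zero ga_mult_ga_of perm_rep_ga_of free_group_def hom
        perm_mat_mult[OF word_act_permutes[OF \<sigma>]]
        left_mult_zero_mat[OF perm_mat_carrier] right_mult_zero_mat[OF perm_mat_carrier])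
qed

lemma perm_rep_prod:
  assumes \<sigma>: "\<And>i. \<sigma> i permutes {..<d}" and "set ss \<subseteq> I_group (free_group I)"
  shows "perm_rep d \<sigma> (ga_prod (free_group I) ss) = mat_prod d (map (perm_rep d \<sigma>) ss)"
  using assms(2)
proof (induction ss)
  case Nil
  have "word_act \<sigma> [] = id" by (simp add: fun_eq_iff)
  then show ?case by (simp add: ga_prod_def mat_prod_def free_group_def perm_rep_ga_of perm_mat_id)
next
  case (Cons p ss)
  then show ?case
    using perm_rep_mult[OF \<sigma>, of p I "ga_prod (free_group I) ss"] I_group_prod[OF group_free_group, of ss I]
    by (simp add: ga_prod_def mat_prod_def)
qed

text \<open>
  A permutation representation is multiplicative without error and takes group elements to
  permutation matrices, so only the trace condition restricts the choice of \<open>\<sigma>\<close>. The trace at a group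
  element is its proportion of fixed points.
\<close>

lemma perm_rep_SA:
  fixes \<delta> :: real and F :: "(('i \<times> bool) list \<Rightarrow>\<^sub>0 complex) set"
  assumes \<sigma>: "\<And>i. \<sigma> i permutes {..<d}" and F: "F \<subseteq> I_group (free_group I)"
    and \<delta>: "0 < \<delta>" and d: "0 < d"
    and fixed: "\<And>w. w \<noteq> [] \<Longrightarrow>
      ga_of w \<in> ga_powers_upto (free_group I) (F \<union> ga_star (free_group I) ` F) n \<Longrightarrow>
      real (card {a \<in> {..<d}. word_act \<sigma> w a = a}) < \<delta> * real d"
  shows "perm_rep d \<sigma> \<in> SA (free_group I) F n \<delta> d"
proof -
  let ?G = "free_group I"
  let ?S = "F \<union> ga_star ?G ` F"
  have S: "?S \<subseteq> I_group ?G" using F I_group_star[OF group_free_group] by blast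
  note powers = ga_powers_upto_I_group[OF group_free_group S]
  have "norm_2 d (perm_rep d \<sigma> (ga_prod ?G ss) - mat_prod d (map (perm_rep d \<sigma>) ss)) < \<delta>"
    if "set ss \<subseteq> ?S" for ss
  proof -
    have "perm_rep d \<sigma> (ga_prod ?G ss) - mat_prod d (map (perm_rep d \<sigma>) ss) = 0\<^sub>m d d"
      unfolding perm_rep_prod[OF \<sigma> subset_trans[OF that S], symmetric]
      by (rule minus_r_inv_mat) (simp add: perm_rep_def)
    moreover have "norm_2 d (0\<^sub>m d d) = 0"
      by (auto simp: norm_2_eq intro!: sum.neutral)
    ultimately show ?thesis using \<delta> by simp
  qed
  moreover have "perm_rep d \<sigma> p \<in> partial_permutation_mats d" if "p \<in> I_group ?G" for p
    using that perm_mat_partial_permutation[OF word_act_permutes[OF \<sigma>]] zero_partial_permutation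
    by (auto simp: I_group_def perm_rep_ga_of perm_rep_zero)
  moreover have "cmod (normalized_trace d (perm_rep d \<sigma> p) - ga_trace ?G p) < \<delta>"
    if p: "p \<in> ga_powers_upto ?G ?S n" for p
  proof -
    have "p \<in> I_group ?G" using p powers by auto
    then consider "p = 0" | "p = ga_of []" | w where "p = ga_of w" "w \<noteq> []"
      unfolding I_group_def by auto
    then show ?thesis
    proof cases
      case 1
      then show ?thesis using \<delta> by (simp add: perm_rep_zero normalized_trace_def ga_trace_def)
    next
      case 2
      have "normalized_trace d (perm_rep d \<sigma> p) = 1"
        using d by (simp add: 2 perm_rep_ga_of normalized_trace_perm_mat)
      moreover have "ga_trace ?G p = 1" by (simp add: 2 ga_trace_def ga_of_def free_group_def)
      ultimately show ?thesis using \<delta> by simp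
    next
      case (3 w)
      have "ga_trace ?G p = 0" using 3 by (simp add: ga_trace_def ga_of_def free_group_def lookup_single_not_eq)
      moreover have "real (card {a \<in> {..<d}. word_act \<sigma> w a = a}) / real d < \<delta>"
        using fixed[OF 3(2)] p 3(1) d by (simp add: pos_divide_less_eq)
      ultimately show ?thesis using 3
        by (simp add: perm_rep_ga_of normalized_trace_perm_mat norm_divide)
    qed
  qed
  ultimately show ?thesis
    using perm_rep_linear[of d \<sigma> ?G] powers unfolding SA_def Let_def by blast
qed

section \<open>The lower bound\<close>

text \<open>
  A tuple on \<open>J\<close> extends to \<open>K\<close> in \<open>fact d\<close> ways for each further generator, so the tuples in \<open>A\<close>
  restrict to at least half of all tuples on \<open>J\<close>.
\<close>

lemma card_restrict_perm_tuples_ge: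
  assumes K: "finite K" "J \<subseteq> K" and A: "A \<subseteq> perm_tuples K d" "real (card (perm_tuples K d)) / 2 \<le> real (card A)"
  shows "fact d ^ card J / 2 \<le> real (card ((\<lambda>\<sigma>. restrict \<sigma> J) ` A))"
proof -
  let ?P = "(\<lambda>\<sigma>. restrict \<sigma> J) ` A"
  let ?f = "\<lambda>\<sigma>. (restrict \<sigma> J, restrict \<sigma> (K - J))"
  have finJ: "finite J" using K finite_subset by auto
  have finA: "finite A" using A(1) finite_perm_tuples[OF K(1)] finite_subset by auto
  have "inj_on ?f A"
  proof (rule inj_onI)
    fix \<sigma> \<tau> assume h: "\<sigma> \<in> A" "\<tau> \<in> A" "?f \<sigma> = ?f \<tau>"
    have "\<sigma> i = \<tau> i" for i
    proof -
      consider "i \<in> J" | "i \<in> K - J" | "i \<notin> K" using K by auto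
      then show ?thesis
      proof cases
        case 1
        then show ?thesis using h(3) by (metis (mono_tags, lifting) Pair_inject restrict_apply')
      next
        case 2
        then show ?thesis using h(3) by (metis (mono_tags, lifting) Pair_inject restrict_apply')
      next
        case 3
        moreover have "\<sigma> \<in> perm_tuples K d" "\<tau> \<in> perm_tuples K d" using h(1,2) A(1) by auto
        ultimately show ?thesis by (simp add: perm_tuples_def PiE_def extensional_def)
      qed
    qed
    then show "\<sigma> = \<tau>" by auto
  qed
  moreover have "?f ` A \<subseteq> ?P \<times> perm_tuples (K - J) d"
    using A(1) by (fastforce simp: perm_tuples_def restrict_PiE_iff)
  moreover have "finite (?P \<times> perm_tuples (K - J) d)"
    using finA K by (simp add: finite_perm_tuples)
  ultimately have "card A \<le> card (?P \<times> perm_tuples (K - J) d)" by (rule card_inj_on_le)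
  also have "\<dots> = card ?P * fact d ^ card (K - J)"
    using K by (simp add: card_cartesian_product card_perm_tuples)
  finally have "real (card A) \<le> real (card ?P) * fact d ^ card (K - J)"
    using of_nat_mono[of "card A" "card ?P * fact d ^ card (K - J)", where 'a = real] by simp
  moreover have "real (card (perm_tuples K d)) = fact d ^ card J * fact d ^ card (K - J)"
    using K finJ card_mono[OF K] by (simp add: card_perm_tuples card_Diff_subset power_add[symmetric])
  ultimately have "fact d ^ card J / 2 * fact d ^ card (K - J) \<le> real (card ?P) * fact d ^ card (K - J)"
    using A(2) by linarith
  then show ?thesis by (rule mult_right_le_imp_le) simp
qed

text \<open>
  \<open>d\<^sup>d / d!\<close> is one of the terms of the exponential series for \<open>exp d\<close>.
\<close>

lemma ln_fact_ge:
  assumes "0 < d"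
  shows "real d * ln (real d) - real d \<le> ln (fact d)"
proof -
  have "(\<Sum>n\<in>{d}. real d ^ n /\<^sub>R fact n) \<le> suminf (\<lambda>n. real d ^ n /\<^sub>R fact n)"
    by (rule sum_le_suminf[OF summable_exp_generic]) auto
  then have "real d ^ d / fact d \<le> exp (real d)"
    by (simp add: exp_def divide_inverse mult.commute)
  moreover have "0 < real d ^ d / fact d" using assms by simp
  ultimately have "ln (real d ^ d / fact d) \<le> ln (exp (real d))" by (subst ln_le_cancel_iff) auto
  then have "ln (real d ^ d / fact d) \<le> real d" by simp
  then show ?thesis using assms by (simp add: ln_div ln_realpow)
qed

lemma ln_card_ge:
  assumes "0 < x" "finite A \<Longrightarrow> x \<le> real (card A)"
  shows "ereal (ln x) \<le> ln_card A"
proof (cases "finite A")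
  case True
  then have "A \<noteq> {}" using assms by auto
  then show ?thesis using True assms by (simp add: ln_card_def)
qed (simp add: ln_card_def)

lemma finite_ga_powers_upto:
  assumes "finite S"
  shows "finite (ga_powers_upto G S n)"
proof -
  have "ga_powers_upto G S n \<subseteq> ga_prod G ` {ss. set ss \<subseteq> S \<and> length ss \<le> n}"
    by (auto simp: ga_powers_upto_def)
  then show ?thesis using finite_lists_length_le[OF assms] finite_subset by blast
qed

text \<open>
  The trace conditions concern a finite set \<open>W\<close> of words. Let the finite set \<open>K\<close> contain \<open>J\<close> and their
  generators, and let all other generators act trivially. At least half of the tuples on \<open>K\<close> then give
  sofic approximations, and the values at the generators in \<open>J\<close> determine the tuple on \<open>J\<close>.
\<close>

lemma card_restrictions_ge:
  fixes \<delta> :: real and I :: "'i set"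
  assumes J: "finite J" "J \<subseteq> I" and F: "finite F" "F \<subseteq> I_group (free_group I)" and \<delta>: "0 < \<delta>"
  shows "eventually (\<lambda>d. ereal (ln (fact d ^ card J / 2)) \<le>
    ln_card ((\<lambda>\<phi>. restrict \<phi> ((\<lambda>i. ga_of [(i, True)]) ` J)) ` SA (free_group I) F n \<delta> d)) sequentially"
proof -
  let ?G = "free_group I"
  let ?E = "(\<lambda>i. ga_of [(i, True)]) ` J"
  let ?P = "ga_powers_upto ?G (F \<union> ga_star ?G ` F) n"
  have S: "F \<union> ga_star ?G ` F \<subseteq> I_group ?G" using F(2) I_group_star[OF group_free_group] by blast
  define W where "W = {w. w \<noteq> [] \<and> ga_of w \<in> ?P}"
  have finW: "finite W"
  proof -
    have "finite (ga_of -` ?P)"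
      using F(1) by (intro finite_vimageI finite_ga_powers_upto inj_ga_of) auto
    then show ?thesis by (rule rev_finite_subset) (auto simp: W_def)
  qed
  define K where "K = J \<union> (\<Union>w\<in>W. fst ` set w)"
  have K: "finite K" "J \<subseteq> K" using J finW by (auto simp: K_def)
  have W: "reduced w \<and> fst ` set w \<subseteq> K \<and> w \<noteq> []" if "w \<in> W" for w
  proof -
    have "ga_of w \<in> I_group ?G"
      using that ga_powers_upto_I_group[OF group_free_group S] by (auto simp: W_def)
    moreover have "ga_of w \<noteq> 0" unfolding ga_of_def by (metis keys_single keys_zero insert_not_empty zero_neq_one)
    ultimately have "w \<in> carrier ?G" using inj_ga_of by (auto simp: I_group_def dest: injD)
    then show ?thesis using that by (auto simp: K_def W_def free_group_def)
  qed
  show ?thesis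
  proof (rule eventually_mono[OF eventually_conj[OF most_tuples_few_fixed_points[OF K(1) finW W \<delta>] eventually_gt_at_top[of 0]]], assumption, elim conjE)
    fix d :: nat
    let ?A = "{\<sigma> \<in> perm_tuples K d. \<forall>w\<in>W. real (card {a \<in> {..<d}. word_act \<sigma> w a = a}) < \<delta> * real d}"
    assume half: "real (card (perm_tuples K d)) / 2 \<le> real (card ?A)" and d: "0 < d"
    define ext where "ext \<sigma> = (\<lambda>i. if i \<in> K then \<sigma> i else id)" for \<sigma> :: "'i \<Rightarrow> nat \<Rightarrow> nat"
    let ?R = "(\<lambda>\<phi>. restrict \<phi> ?E) ` SA ?G F n \<delta> d"
    let ?g = "\<lambda>\<sigma>. restrict (perm_rep d (ext \<sigma>)) ?E"
    have ext_perm: "ext \<sigma> i permutes {..<d}" if "\<sigma> \<in> perm_tuples K d" for \<sigma> i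
      using perm_tuples_permutes[OF that] by (simp add: ext_def permutes_id)
    have ext_word: "word_act (ext \<sigma>) w = word_act \<sigma> w" if "fst ` set w \<subseteq> K" for \<sigma> w
      using that
    proof (induction w)
      case (Cons x w)
      then show ?case by (auto simp: fun_eq_iff letter_act_def ext_def)
    qed (simp add: fun_eq_iff)
    have SA: "perm_rep d (ext \<sigma>) \<in> SA ?G F n \<delta> d" if \<sigma>: "\<sigma> \<in> ?A" for \<sigma>
    proof (rule perm_rep_SA[OF _ F(2) \<delta> d])
      show "ext \<sigma> i permutes {..<d}" for i using \<sigma> ext_perm by simp
      fix w assume "w \<noteq> []" "ga_of w \<in> ?P"
      then have w: "w \<in> W" by (simp add: W_def)
      then show "real (card {a \<in> {..<d}. word_act (ext \<sigma>) w a = a}) < \<delta> * real d"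
        using \<sigma> W[OF w] ext_word[of w] by simp
    qed
    have fact_pos: "0 < (fact d ^ card J / 2 :: real)" by simp
    have "fact d ^ card J / 2 \<le> real (card ?R)" if fin: "finite ?R"
    proof -
      have sub: "?g ` ?A \<subseteq> ?R" using SA by blast
      have det: "restrict \<sigma> J = restrict \<tau> J" if h: "\<sigma> \<in> ?A" "\<tau> \<in> ?A" "?g \<sigma> = ?g \<tau>" for \<sigma> \<tau>
      proof (rule restrict_ext)
        fix i assume i: "i \<in> J"
        have iK: "i \<in> K" using i K by auto
        have w: "word_act (ext \<rho>) [(i, True)] = \<rho> i" for \<rho> :: "'i \<Rightarrow> nat \<Rightarrow> nat"
          using iK by (simp add: fun_eq_iff letter_act_def ext_def)
        have "perm_rep d (ext \<sigma>) (ga_of [(i, True)]) = perm_rep d (ext \<tau>) (ga_of [(i, True)])"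
          using fun_cong[OF h(3), of "ga_of [(i, True)]"] i by simp
        then have "perm_mat d (\<sigma> i) = perm_mat d (\<tau> i)" by (simp add: perm_rep_ga_of w)
        then show "\<sigma> i = \<tau> i"
          using h(1,2) iK perm_tuples_permutes by (intro perm_mat_inject) auto
      qed
      have "card ((\<lambda>\<sigma>. restrict \<sigma> J) ` ?A) \<le> card (?g ` ?A)"
        using card_image_le_of_factor[of ?g ?A "\<lambda>\<sigma>. restrict \<sigma> J"] det finite_subset[OF sub fin] by blast
      also have "\<dots> \<le> card ?R" using fin sub by (rule card_mono)
      finally have "real (card ((\<lambda>\<sigma>. restrict \<sigma> J) ` ?A)) \<le> real (card ?R)" by simp
      moreover have "fact d ^ card J / 2 \<le> real (card ((\<lambda>\<sigma>. restrict \<sigma> J) ` ?A))"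
        by (rule card_restrict_perm_tuples_ge[OF K _ half]) auto
      ultimately show ?thesis by linarith
    qed
    then show "ereal (ln (fact d ^ card J / 2)) \<le> ln_card ?R"
      by (rule ln_card_ge[OF fact_pos])
  qed
qed

lemma liminf_rate_ge:
  fixes \<delta> :: real and I :: "'i set"
  assumes J: "finite J" "J \<subseteq> I" and F: "finite F" "F \<subseteq> I_group (free_group I)" and \<delta>: "0 < \<delta>"
  shows "ereal (card J) \<le> sofic_rate liminf (free_group I) ((\<lambda>i. ga_of [(i, True)]) ` J) F n \<delta>"
proof -
  let ?k = "real (card J)"
  let ?R = "\<lambda>d. (\<lambda>\<phi>. restrict \<phi> ((\<lambda>i. ga_of [(i, True)]) ` J)) ` SA (free_group I) F n \<delta> d"
  let ?u = "\<lambda>d. ?k * (real d * ln (real d) - real d) - ln 2"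
  let ?r = "\<lambda>d. ?u d / (real d * ln (real d))"
  have "(\<lambda>d::nat. (real d * ln (real d) - real d) / (real d * ln (real d))) \<longlonglongrightarrow> 1" by real_asymp
  moreover have "(\<lambda>d::nat. ln 2 / (real d * ln (real d))) \<longlonglongrightarrow> 0" by real_asymp
  ultimately have "(\<lambda>d. ?k * ((real d * ln (real d) - real d) / (real d * ln (real d)))
      - ln 2 / (real d * ln (real d))) \<longlonglongrightarrow> ?k * 1 - 0"
    by (intro tendsto_diff tendsto_mult tendsto_const)
  then have "?r \<longlonglongrightarrow> ?k * 1 - 0"
    by (simp only: diff_divide_distrib[of "?k * _"] times_divide_eq_right)
  then have "?r \<longlonglongrightarrow> ?k" by simp
  then have "ereal ?k = liminf (\<lambda>d. ereal (?r d))"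
    by (intro lim_imp_Liminf[symmetric]) auto
  also have "\<dots> \<le> liminf (\<lambda>d. ln_card (?R d) / ereal (real d * ln (real d)))"
  proof (rule Liminf_mono, rule eventually_mono[OF eventually_conj[OF
        card_restrictions_ge[OF J F \<delta>] eventually_ge_at_top[of 2]]], elim conjE)
    fix d :: nat
    assume le: "ereal (ln (fact d ^ card J / 2)) \<le> ln_card (?R d)" and d: "2 \<le> d"
    have "?u d \<le> ?k * ln (fact d) - ln 2"
      using ln_fact_ge[of d] d by (intro diff_right_mono mult_left_mono) auto
    also have "\<dots> = ln (fact d ^ card J / 2)" by (simp add: ln_div ln_realpow)
    finally have "ereal (?u d) \<le> ln_card (?R d)" using le by (simp add: order_trans[OF _ le])
    then have "ereal (?u d) / ereal (real d * ln (real d)) \<le> ln_card (?R d) / ereal (real d * ln (real d))"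
      using d by (intro ereal_divide_right_mono) auto
    then show "ereal (?r d) \<le> ln_card (?R d) / ereal (real d * ln (real d))" using d by simp
  qed
  finally show ?thesis unfolding sofic_rate_def .
qed

text \<open>
  The generators in \<open>J\<close> serve as \<open>E\<close>, whatever \<open>F\<close>, \<open>n\<close> and \<open>\<delta>\<close> are.
\<close>

theorem lower_sofic_dimension_free_group_ge:
  assumes J: "finite J" "J \<subseteq> I"
  shows "ereal (card J) \<le> lower_sofic_dimension (free_group I)"
proof -
  have "(\<lambda>i. ga_of [(i, True)]) ` J \<subseteq> I_group (free_group I)"
    using J(2) by (auto simp: I_group_def free_group_def reduced_def)
  then show ?thesis
    unfolding lower_sofic_dimension_def sofic_dimension_with_def
    using J liminf_rate_ge[OF J]
    by (intro SUP_upper2[of "(\<lambda>i. ga_of [(i, True)]) ` J"] INF_greatest) auto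
qed

section \<open>Sofic dimension of the free groups\<close>

lemma lower_sofic_dimension_le: "lower_sofic_dimension G \<le> sofic_dimension G"
  unfolding lower_sofic_dimension_def sofic_dimension_def sofic_dimension_with_def sofic_rate_def
  by (intro SUP_mono' INF_mono' Liminf_le_Limsup) simp

theorem corollary4p11:
  fixes r :: enat
  assumes "1 \<le> r"
  shows "sofic_dimension (free_group_of_rank r) = ereal_of_enat r \<and>
         lower_sofic_dimension (free_group_of_rank r) = ereal_of_enat r"
proof (cases r)
  case (enat k)
  then have G: "free_group_of_rank r = free_group {..<k}"
    by (simp add: free_group_of_rank_def lessThan_def)
  have "sofic_dimension (free_group {..<k}) \<le> ereal k"
    using sofic_dimension_free_group_le[of "{..<k}"] by simp
  moreover have "ereal k \<le> lower_sofic_dimension (free_group {..<k})"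
    using lower_sofic_dimension_free_group_ge[of "{..<k}" "{..<k}"] by simp
  moreover note lower_sofic_dimension_le[of "free_group {..<k}"]
  ultimately show ?thesis unfolding G by (auto simp: enat intro: antisym order_trans)
next
  case infinity
  then have G: "free_group_of_rank r = free_group UNIV"
    by (simp add: free_group_of_rank_def)
  have "ereal k \<le> lower_sofic_dimension (free_group (UNIV :: nat set))" for k :: nat
    using lower_sofic_dimension_free_group_ge[of "{..<k}" UNIV] by simp
  then have "lower_sofic_dimension (free_group (UNIV :: nat set)) = \<infinity>"
    by (intro ereal_top) (meson ereal_less_eq(3) order_trans real_arch_simple)
  then show ?thesis
    using lower_sofic_dimension_le[of "free_group (UNIV :: nat set)"] unfolding G by (simp add: infinity)
qed

end
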